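(* If the following problem can be solved by a polynomial-time algorithm, then 3Sat can also be solved by a polynomial-time algorithm. Problem. Input: a dimension $d\ge1$, positive definite matrices $\Sigma^{(1)},\Sigma^{(2)}\in\mathbb R^{d\times d}$ and vectors $u^{(1)},u^{(2)}\in\mathbb R^d$, where $Y^{(e)}=(\beta^{(e,[d])})^\top X^{(e)}$ (no intrinsic noise). Output: a vector $\bar\beta\in\mathbb R^d$ such that, if $\{S\subseteq[d]:\beta^{(1,S)}=\beta^{(2,S)}\neq0\}\neq\emptyset$, then $$\inf_{S:\ \beta^{(1,S)}=\beta^{(2,S)}=\beta^{(S)}\neq0}\ \frac{\|\bar\beta-\beta^{(S)}\|_\Sigma^2}{\sum_{e\in[2]}\mathbb E[|Y^{(e)}|^2]}<(20d)^{-1};$$ otherwise $\bar\beta$ may be an arbitrary $d$-dimensional vector.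
   Context: Here $\Sigma^{(e)}=\mathbb E[X^{(e)}(X^{(e)})^\top]$ and $u^{(e)}=\mathbb E[X^{(e)}Y^{(e)}]$ for zero-mean $X^{(e)}\in\mathbb R^d$, $Y^{(e)}\in\mathbb R$. For $S\subseteq[d]$, $\beta^{(e,S)}\in\mathbb R^d$ has $\beta^{(e,S)}_S=(\Sigma_S^{(e)})^{-1}u_S^{(e)}$ and $\beta^{(e,S)}_{S^c}=0$; $\beta^{(S)}\in\mathbb R^d$ has $\beta^{(S)}_S=(\Sigma^{(1)}_S+\Sigma^{(2)}_S)^{-1}(u^{(1)}_S+u^{(2)}_S)$ and $\beta^{(S)}_{S^c}=0$ (subscript $S$: subvector / principal submatrix). Since there is no intrinsic noise, $\mathbb E[|Y^{(e)}|^2]=(u^{(e)})^\top(\Sigma^{(e)})^{-1}u^{(e)}$. Also $\Sigma=\frac12(\Sigma^{(1)}+\Sigma^{(2)})$ and $\|z\|_\Sigma=\sqrt{z^\top\Sigma z}$. Inputs and outputs have rational entries encoded in binary. 3Sat: given a formula $\bigwedge_{i=1}^k(l_{i,1}\lor l_{i,2}\lor l_{i,3})$ whose literals are boolean variables or their negations, decide whether there is an assignment of the variables making it True. *)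

theory Defs
  imports
    "HOL-Computational_Algebra.Polynomial"
    "Jordan_Normal_Form.Gauss_Jordan_Elimination"
    "Jordan_Normal_Form.DL_Submatrix"
begin

section \<open>Polynomial-time computation\<close>

text \<open>
  The model of computation is the WHILE language over binary trees (N. D. Jones, Computability
  and Complexity), with a cost measure that charges for data volume: reading a register copies the
  whole tree in it, so the cost of an expression is at least the size of its value
  (lemma size_eval_le_cost below).  Without this charge, sharing would allow
  trees of exponential size to be built in linearly many steps.  With it, a program and a
  (multitape) Turing machine simulate each other with polynomial overhead, so that the
  polynomial-time solvable problems are the usual ones.
\<close>

datatype tree = Leaf | Node tree tree

fun left :: "tree \<Rightarrow> tree" where
  "left Leaf = Leaf"
| "left (Node l r) = l"

fun right :: "tree \<Rightarrow> tree" where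
  "right Leaf = Leaf"
| "right (Node l r) = r"

type_synonym store = "nat \<Rightarrow> tree"

datatype exp = Var nat | Nil_exp | Cons_exp exp exp | Left_exp exp | Right_exp exp

fun eval :: "exp \<Rightarrow> store \<Rightarrow> tree" where
  "eval (Var x) s = s x"
| "eval Nil_exp s = Leaf"
| "eval (Cons_exp a b) s = Node (eval a s) (eval b s)"
| "eval (Left_exp a) s = left (eval a s)"
| "eval (Right_exp a) s = right (eval a s)"

fun cost :: "exp \<Rightarrow> store \<Rightarrow> nat" where
  "cost (Var x) s = 1 + size (s x)"
| "cost Nil_exp s = 1"
| "cost (Cons_exp a b) s = 1 + cost a s + cost b s"
| "cost (Left_exp a) s = 1 + cost a s"
| "cost (Right_exp a) s = 1 + cost a s"

lemma size_eval_le_cost: "size (eval e s) \<le> cost e s"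
proof (induction e)
  case (Left_exp e)
  then show ?case by (cases "eval e s") auto
next
  case (Right_exp e)
  then show ?case by (cases "eval e s") auto
qed auto

datatype com =
    Skip
  | Assign nat exp
  | Seq com com
  | Cond exp com com
  | While exp com

text \<open>
  \<open>exec c s t s'\<close>: program \<open>c\<close> started in \<open>s\<close> terminates in \<open>s'\<close> after time \<open>t\<close>.  A test succeeds
  iff its value is not \<open>Leaf\<close>.
\<close>

inductive exec :: "com \<Rightarrow> store \<Rightarrow> nat \<Rightarrow> store \<Rightarrow> bool" where
  Skip: "exec Skip s 1 s"
| Assign: "exec (Assign x e) s (1 + cost e s) (s(x := eval e s))"
| Seq: "exec c1 s t1 s1 \<Longrightarrow> exec c2 s1 t2 s2 \<Longrightarrow> exec (Seq c1 c2) s (t1 + t2) s2"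
| CondTrue: "eval e s \<noteq> Leaf \<Longrightarrow> exec c1 s t s1 \<Longrightarrow> exec (Cond e c1 c2) s (1 + cost e s + t) s1"
| CondFalse: "eval e s = Leaf \<Longrightarrow> exec c2 s t s2 \<Longrightarrow> exec (Cond e c1 c2) s (1 + cost e s + t) s2"
| WhileFalse: "eval e s = Leaf \<Longrightarrow> exec (While e c) s (1 + cost e s) s"
| WhileTrue: "eval e s \<noteq> Leaf \<Longrightarrow> exec c s t1 s1 \<Longrightarrow> exec (While e c) s1 t2 s2 \<Longrightarrow>
    exec (While e c) s (1 + cost e s + t1 + t2) s2"

lemma exec_deterministic:
  "exec c s t s' \<Longrightarrow> exec c s t' s'' \<Longrightarrow> t' = t \<and> s'' = s'"
proof (induction arbitrary: t' s'' rule: exec.induct)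
  case (Seq c1 s t1 s1 c2 t2 s2)
  from Seq.prems show ?case by cases (use Seq.IH in blast)
next
  case (CondTrue e s c1 t s1 c2)
  from CondTrue.prems show ?case by cases (use CondTrue in blast)+
next
  case (CondFalse e s c2 t s2 c1)
  from CondFalse.prems show ?case by cases (use CondFalse in blast)+
next
  case (WhileFalse e s c)
  from WhileFalse.prems show ?case by cases (use WhileFalse in auto)
next
  case (WhileTrue e s c t1 s1 t2 s2)
  from WhileTrue.prems show ?case by cases (use WhileTrue in blast)+
qed (auto elim: exec.cases)

text \<open>
  The input is placed in register 0, the other registers are empty; the output is read off
  register 0.
\<close>

definition init_store :: "tree \<Rightarrow> store" where
  "init_store x = (\<lambda>_. Leaf)(0 := x)"

text \<open>
  A computational problem has admissible inputs \<open>valid\<close> and a relation \<open>sol\<close> between inputs and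
  correct outputs; nothing is required of a program on inadmissible inputs.
\<close>

definition poly_time_solvable ::
  "('a \<Rightarrow> tree) \<Rightarrow> ('b \<Rightarrow> tree) \<Rightarrow> ('a \<Rightarrow> bool) \<Rightarrow> ('a \<Rightarrow> 'b \<Rightarrow> bool) \<Rightarrow> bool" where
  "poly_time_solvable enc_in enc_out valid sol \<longleftrightarrow>
    (\<exists>c (p :: nat poly). \<forall>x. valid x \<longrightarrow>
      (\<exists>t s y. exec c (init_store (enc_in x)) t s \<and> t \<le> poly p (size (enc_in x)) \<and>
        s 0 = enc_out y \<and> sol x y))"


section \<open>Encodings\<close>

fun enc_bool :: "bool \<Rightarrow> tree" where
  "enc_bool False = Leaf"
| "enc_bool True = Node Leaf Leaf"

fun enc_list :: "('a \<Rightarrow> tree) \<Rightarrow> 'a list \<Rightarrow> tree" where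
  "enc_list f [] = Leaf"
| "enc_list f (x # xs) = Node (f x) (enc_list f xs)"

text \<open>Binary digits, least significant first, without leading zeros.\<close>

fun bits :: "nat \<Rightarrow> bool list" where
  "bits n = (if n = 0 then [] else odd n # bits (n div 2))"

declare bits.simps [simp del]

definition enc_nat :: "nat \<Rightarrow> tree" where
  "enc_nat n = enc_list enc_bool (bits n)"

definition enc_int :: "int \<Rightarrow> tree" where
  "enc_int z = Node (enc_bool (z < 0)) (enc_nat (nat \<bar>z\<bar>))"

text \<open>Numerator and denominator in lowest terms, denominator positive.\<close>

definition enc_rat :: "rat \<Rightarrow> tree" where
  "enc_rat q = (case quotient_of q of (a, b) \<Rightarrow> Node (enc_int a) (enc_nat (nat b)))"

definition enc_vec :: "rat vec \<Rightarrow> tree" where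
  "enc_vec v = enc_list enc_rat (list_of_vec v)"

definition enc_mat :: "rat mat \<Rightarrow> tree" where
  "enc_mat A = enc_list (enc_list enc_rat) (mat_to_list A)"


section \<open>3Sat\<close>

datatype literal = Pos nat | Neg nat

type_synonym formula3 = "(literal \<times> literal \<times> literal) list"

fun lit_true :: "(nat \<Rightarrow> bool) \<Rightarrow> literal \<Rightarrow> bool" where
  "lit_true \<alpha> (Pos x) \<longleftrightarrow> \<alpha> x"
| "lit_true \<alpha> (Neg x) \<longleftrightarrow> \<not> \<alpha> x"

definition satisfiable :: "formula3 \<Rightarrow> bool" where
  "satisfiable \<phi> \<longleftrightarrow>
    (\<exists>\<alpha>. \<forall>(l1, l2, l3) \<in> set \<phi>. lit_true \<alpha> l1 \<or> lit_true \<alpha> l2 \<or> lit_true \<alpha> l3)"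

fun enc_literal :: "literal \<Rightarrow> tree" where
  "enc_literal (Pos x) = Node (enc_bool True) (enc_nat x)"
| "enc_literal (Neg x) = Node (enc_bool False) (enc_nat x)"

fun enc_clause :: "literal \<times> literal \<times> literal \<Rightarrow> tree" where
  "enc_clause (l1, l2, l3) = Node (enc_literal l1) (Node (enc_literal l2) (enc_literal l3))"

definition enc_formula :: "formula3 \<Rightarrow> tree" where
  "enc_formula \<phi> = enc_list enc_clause \<phi>"


section \<open>Invariant least squares solutions\<close>

text \<open>Coordinates are indexed by \<open>{..<d}\<close>.\<close>

definition pos_def :: "real mat \<Rightarrow> bool" where
  "pos_def A \<longleftrightarrow> square_mat A \<and> transpose_mat A = A \<and>
    (\<forall>x \<in> carrier_vec (dim_row A). x \<noteq> 0\<^sub>v (dim_row A) \<longrightarrow> x \<bullet> (A *\<^sub>v x) > 0)"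

text \<open>Only used for invertible matrices: a principal submatrix of a positive definite matrix is one.\<close>

definition inv_mat :: "real mat \<Rightarrow> real mat" where
  "inv_mat A = the (mat_inverse A)"

definition subvector :: "real vec \<Rightarrow> nat set \<Rightarrow> real vec" where
  "subvector u S = vec (card {i. i < dim_vec u \<and> i \<in> S}) (\<lambda>i. u $ pick S i)"

text \<open>The vector of dimension \<open>d\<close> with subvector \<open>w\<close> on \<open>S\<close> and zero elsewhere.\<close>

definition zero_extend :: "nat \<Rightarrow> nat set \<Rightarrow> real vec \<Rightarrow> real vec" where
  "zero_extend d S w = vec d (\<lambda>i. if i \<in> S then w $ card {a \<in> S. a < i} else 0)"

definition env_sol :: "real mat \<Rightarrow> real vec \<Rightarrow> nat set \<Rightarrow> real vec" where
  "env_sol A u S = zero_extend (dim_vec u) S (inv_mat (submatrix A S S) *\<^sub>v subvector u S)"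

definition pooled_sol ::
  "real mat \<Rightarrow> real mat \<Rightarrow> real vec \<Rightarrow> real vec \<Rightarrow> nat set \<Rightarrow> real vec" where
  "pooled_sol A1 A2 u1 u2 S = zero_extend (dim_vec u1) S
    (inv_mat (submatrix A1 S S + submatrix A2 S S) *\<^sub>v (subvector u1 S + subvector u2 S))"

text \<open>
  The second moment of the response \<open>Y\<close> when \<open>Y\<close> is the linear function of \<open>X\<close> with coefficient
  vector \<open>inv_mat A *\<^sub>v u\<close>, where \<open>A\<close> is the covariance matrix of \<open>X\<close> and \<open>u\<close> that of \<open>X\<close> with \<open>Y\<close>.
\<close>

definition response_moment :: "real mat \<Rightarrow> real vec \<Rightarrow> real" where
  "response_moment A u = u \<bullet> (inv_mat A *\<^sub>v u)"

definition weighted_norm :: "real mat \<Rightarrow> real vec \<Rightarrow> real" where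
  "weighted_norm A z = sqrt (z \<bullet> (A *\<^sub>v z))"

definition approximates_invariant ::
  "nat \<Rightarrow> real mat \<Rightarrow> real mat \<Rightarrow> real vec \<Rightarrow> real vec \<Rightarrow> real vec \<Rightarrow> bool" where
  "approximates_invariant d A1 A2 u1 u2 b \<longleftrightarrow>
    ({S. S \<subseteq> {..<d} \<and> env_sol A1 u1 S = env_sol A2 u2 S \<and> env_sol A2 u2 S \<noteq> 0\<^sub>v d} \<noteq> {} \<longrightarrow>
     (INF S \<in> {S. S \<subseteq> {..<d} \<and> env_sol A1 u1 S = env_sol A2 u2 S \<and>
                  env_sol A2 u2 S = pooled_sol A1 A2 u1 u2 S \<and> pooled_sol A1 A2 u1 u2 S \<noteq> 0\<^sub>v d}.
        (weighted_norm ((1 / 2) \<cdot>\<^sub>m (A1 + A2)) (b - pooled_sol A1 A2 u1 u2 S))\<^sup>2 /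
        (response_moment A1 u1 + response_moment A2 u2))
     < 1 / (20 * real d))"


section \<open>The computational problem\<close>

type_synonym instance_data = "nat \<times> rat mat \<times> rat mat \<times> rat vec \<times> rat vec"

abbreviation real_mat :: "rat mat \<Rightarrow> real mat" where
  "real_mat \<equiv> map_mat of_rat"

abbreviation real_vec :: "rat vec \<Rightarrow> real vec" where
  "real_vec \<equiv> map_vec of_rat"

fun valid_instance :: "instance_data \<Rightarrow> bool" where
  "valid_instance (d, A1, A2, u1, u2) \<longleftrightarrow> d \<ge> 1 \<and>
    A1 \<in> carrier_mat d d \<and> A2 \<in> carrier_mat d d \<and> u1 \<in> carrier_vec d \<and> u2 \<in> carrier_vec d \<and>
    pos_def (real_mat A1) \<and> pos_def (real_mat A2)"

fun correct_output :: "instance_data \<Rightarrow> rat vec \<Rightarrow> bool" where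
  "correct_output (d, A1, A2, u1, u2) b \<longleftrightarrow> b \<in> carrier_vec d \<and>
    approximates_invariant d (real_mat A1) (real_mat A2) (real_vec u1) (real_vec u2) (real_vec b)"

fun enc_instance :: "instance_data \<Rightarrow> tree" where
  "enc_instance (d, A1, A2, u1, u2) =
    Node (enc_nat d) (Node (enc_mat A1) (Node (enc_mat A2) (Node (enc_vec u1) (enc_vec u2))))"

end

theory Submission
  imports Defs "Jordan_Normal_Form.Determinant"
begin

text \<open>
  A formula with \<open>k\<close> clauses gives a graph on its \<open>d = 3 k\<close> literal occurrences, in which
  occurrences in different clauses are adjacent unless they are complementary; satisfying
  assignments correspond to cliques of size \<open>k\<close>. Take the first covariance matrix to be the
  identity and \<open>u1 = 3\<close>, so that the first solution on \<open>S\<close> is 3 on \<open>S\<close>. Take the second to be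
  \<open>D I + N\<close>, where \<open>D = 64 d\<^sup>2\<close> and \<open>N\<close> has entry 1 on the diagonal and on edges and \<open>- d\<close> on
  non-edges, and \<open>u2 = 3 (D + k)\<close>. The solutions on a nonempty \<open>S\<close> agree iff every row of \<open>N\<close>
  in \<open>S\<close> sums to \<open>k\<close> over \<open>S\<close>; a single non-edge makes such a sum negative, so this says that
  \<open>S\<close> is a clique of size \<open>k\<close>. Since \<open>D\<close> dominates \<open>N\<close>, the normalised error below
  \<open>1 / (20 d)\<close> forces a Euclidean error below 1, which suffices to read off \<open>S\<close>. The assignment
  obtained in this way is checked against the formula, so that wrong outputs on unsatisfiable
  formulas do no harm.
\<close>

section \<open>Polynomially bounded functions\<close>

text \<open>The formal obstacle is running time: the reduction must be a WHILE program that calls a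
  solver of which only existence is known. Apart from a few combinators no code is written; the
  predicate \<open>ptime_on X f\<close> on functions is closed under composition, branching, bounded
  iteration and list recursion, and the solver enters as one more such function, on the codes of
  valid instances. Numbers such as D are computed in unary as list lengths, which is affordable
  because they are polynomial in the number of clauses.

  The value 3 fits the decoder: errors below 1 leave entries above 2 or below 1 in absolute value,
  and comparing bit lengths resolves a factor of 2. With l = 63 d^2, an error vector z has squared
  weighted norm at least (1 + l) |z|^2 / 2, while the total response moment is at most 10 d (1 + l);
  the quotient of the two at |z| = 1 is the threshold 1 / (20 d). Since D enters both the diagonal
  and u2, it cancels from the normal equations, so positive definiteness does not disturb the
  combinatorics.\<close>

definition poly_bounded :: "(nat \<Rightarrow> nat) \<Rightarrow> bool" where
  "poly_bounded b \<longleftrightarrow> (\<exists>p. \<forall>n. b n \<le> poly p n)"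

lemma poly_nat_mono: "x \<le> y \<Longrightarrow> poly p x \<le> poly p (y :: nat)"
  by (induction p) (auto intro: add_mono mult_mono)

lemma poly_bounded_const: "poly_bounded (\<lambda>n. c)"
  unfolding poly_bounded_def by (rule exI[of _ "[:c:]"]) simp

lemma poly_bounded_id: "poly_bounded (\<lambda>n. n)"
  unfolding poly_bounded_def by (rule exI[of _ "[:0, 1:]"]) simp

lemma poly_bounded_add:
  assumes "poly_bounded a" "poly_bounded b"
  shows "poly_bounded (\<lambda>n. a n + b n)"
proof -
  obtain p q where "\<forall>n. a n \<le> poly p n" "\<forall>n. b n \<le> poly q n"
    using assms unfolding poly_bounded_def by auto
  then have "\<forall>n. a n + b n \<le> poly (p + q) n"
    by (auto intro: add_mono)
  then show ?thesis unfolding poly_bounded_def by blast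
qed

lemma poly_bounded_mult:
  assumes "poly_bounded a" "poly_bounded b"
  shows "poly_bounded (\<lambda>n. a n * b n)"
proof -
  obtain p q where "\<forall>n. a n \<le> poly p n" "\<forall>n. b n \<le> poly q n"
    using assms unfolding poly_bounded_def by auto
  then have "\<forall>n. a n * b n \<le> poly (p * q) n"
    by (auto intro: mult_mono)
  then show ?thesis unfolding poly_bounded_def by blast
qed

lemma poly_bounded_poly:
  assumes "poly_bounded b"
  shows "poly_bounded (\<lambda>n. poly p (b n))"
proof -
  obtain q where "\<forall>n. b n \<le> poly q n"
    using assms unfolding poly_bounded_def by auto
  then have "\<forall>n. poly p (b n) \<le> poly (pcompose p q) n"
    by (auto simp: poly_pcompose intro: poly_nat_mono)
  then show ?thesis unfolding poly_bounded_def by blast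
qed

lemmas poly_bounded_intros =
  poly_bounded_const poly_bounded_id poly_bounded_add poly_bounded_mult poly_bounded_poly


section \<open>Programs and the registers they use\<close>

fun exp_regs :: "exp \<Rightarrow> nat set" where
  "exp_regs (Var x) = {x}"
| "exp_regs Nil_exp = {}"
| "exp_regs (Cons_exp a b) = exp_regs a \<union> exp_regs b"
| "exp_regs (Left_exp a) = exp_regs a"
| "exp_regs (Right_exp a) = exp_regs a"

fun com_regs :: "com \<Rightarrow> nat set" where
  "com_regs Skip = {}"
| "com_regs (Assign x e) = insert x (exp_regs e)"
| "com_regs (Seq c1 c2) = com_regs c1 \<union> com_regs c2"
| "com_regs (Cond e c1 c2) = exp_regs e \<union> com_regs c1 \<union> com_regs c2"
| "com_regs (While e c) = exp_regs e \<union> com_regs c"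

lemma finite_exp_regs: "finite (exp_regs e)"
  by (induction e) auto

lemma finite_com_regs: "finite (com_regs c)"
  by (induction c) (auto simp: finite_exp_regs)

lemma eval_cost_cong:
  "(\<And>i. i \<in> exp_regs e \<Longrightarrow> s i = s' i) \<Longrightarrow> eval e s = eval e s' \<and> cost e s = cost e s'"
  by (induction e) auto

text \<open>Needed to run a program that is specified only from \<open>init_store\<close> in a store
  whose registers outside \<open>R\<close> hold data of a calling program.\<close>

lemma exec_frame:
  assumes "exec c s t s'" and "com_regs c \<subseteq> R" and "\<And>i. i \<in> R \<Longrightarrow> r i = s i"
  shows "exec c r t (\<lambda>i. if i \<in> R then s' i else r i)"
  using assms
proof (induction arbitrary: r rule: exec.induct)
  case (Skip s)
  then have "(\<lambda>i. if i \<in> R then s i else r i) = r" by auto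
  then show ?case by (metis exec.Skip)
next
  case (Assign x e s)
  then have "eval e r = eval e s \<and> cost e r = cost e s"
    by (intro eval_cost_cong) auto
  moreover have "(\<lambda>i. if i \<in> R then (s(x := eval e s)) i else r i) = r(x := eval e s)"
    using Assign by auto
  ultimately show ?case by (metis exec.Assign)
next
  case (Seq c1 s t1 s1 c2 t2 s2)
  let ?r1 = "\<lambda>i. if i \<in> R then s1 i else r i"
  have "exec c1 r t1 ?r1" using Seq by auto
  moreover have "exec c2 ?r1 t2 (\<lambda>i. if i \<in> R then s2 i else ?r1 i)"
    using Seq.prems by (intro Seq.IH(2)) auto
  moreover have "(\<lambda>i. if i \<in> R then s2 i else ?r1 i) = (\<lambda>i. if i \<in> R then s2 i else r i)"
    by auto
  ultimately show ?case by (metis exec.Seq)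
next
  case (CondTrue e s c1 t s1 c2)
  then have "eval e r = eval e s \<and> cost e r = cost e s"
    by (intro eval_cost_cong) auto
  then show ?case using exec.CondTrue[of e r c1 t _ c2] CondTrue by simp
next
  case (CondFalse e s c2 t s2 c1)
  then have "eval e r = eval e s \<and> cost e r = cost e s"
    by (intro eval_cost_cong) auto
  then show ?case using exec.CondFalse[of e r c2 t _ c1] CondFalse by simp
next
  case (WhileFalse e s c)
  then have "eval e r = eval e s \<and> cost e r = cost e s"
    by (intro eval_cost_cong) auto
  moreover have "(\<lambda>i. if i \<in> R then s i else r i) = r" using WhileFalse by auto
  ultimately show ?case using WhileFalse by (metis exec.WhileFalse)
next
  case (WhileTrue e s c t1 s1 t2 s2)
  let ?r1 = "\<lambda>i. if i \<in> R then s1 i else r i"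
  have 1: "eval e r = eval e s \<and> cost e r = cost e s"
    using WhileTrue by (intro eval_cost_cong) auto
  have "exec c r t1 ?r1" using WhileTrue by auto
  moreover have "exec (While e c) ?r1 t2 (\<lambda>i. if i \<in> R then s2 i else ?r1 i)"
    using WhileTrue.prems by (intro WhileTrue.IH(2)) auto
  moreover have "(\<lambda>i. if i \<in> R then s2 i else ?r1 i) = (\<lambda>i. if i \<in> R then s2 i else r i)"
    by auto
  ultimately show ?case using 1 WhileTrue.hyps by (metis exec.WhileTrue)
qed

text \<open>Cost bounds the size of a value, so a time bound is also a bound on the size of the
  result. This keeps compositions polynomial.\<close>

lemma exec_size_growth: "exec c s t s' \<Longrightarrow> size (s' i) \<le> size (s i) + t"
proof (induction rule: exec.induct)
  case (Assign x e s)
  then show ?case using size_eval_le_cost[of e s] by auto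
qed auto


section \<open>Functions on trees computable in polynomial time\<close>

text \<open>
  The program has to restore all registers other than 0, so that programs can be composed; only
  the registers below \<open>n\<close> have to be empty at the start.
\<close>

definition realizes :: "tree set \<Rightarrow> (tree \<Rightarrow> tree) \<Rightarrow> com \<Rightarrow> nat \<Rightarrow> nat poly \<Rightarrow> bool" where
  "realizes X f c n p \<longleftrightarrow> (\<forall>s. s 0 \<in> X \<longrightarrow> (\<forall>i. 0 < i \<and> i < n \<longrightarrow> s i = Leaf) \<longrightarrow>
    (\<exists>t. exec c s t (s(0 := f (s 0))) \<and> t \<le> poly p (size (s 0))))"

text \<open>The domain \<open>X\<close> lets the assumed solver count as a function on trees,
  although it may fail to terminate outside the codes of admissible inputs.\<close>

definition ptime_on :: "tree set \<Rightarrow> (tree \<Rightarrow> tree) \<Rightarrow> bool" where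
  "ptime_on X f \<longleftrightarrow> (\<exists>c n p. 0 < n \<and> realizes X f c n p)"

lemma realizesD:
  assumes "realizes X f c n p" "s 0 \<in> X" "\<And>i. 0 < i \<Longrightarrow> i < n \<Longrightarrow> s i = Leaf"
  obtains t where "exec c s t (s(0 := f (s 0)))" "t \<le> poly p (size (s 0))"
    "size (f (s 0)) \<le> size (s 0) + poly p (size (s 0))"
proof -
  obtain t where t: "exec c s t (s(0 := f (s 0)))" "t \<le> poly p (size (s 0))"
    using assms(1)[unfolded realizes_def, rule_format, of s] assms(2,3) by auto
  from exec_size_growth[OF t(1), of 0] t(2) have "size (f (s 0)) \<le> size (s 0) + poly p (size (s 0))"
    by simp
  with t that show thesis by blast
qed

lemma ptime_onI:
  assumes "poly_bounded b" "0 < n"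
    and "\<And>s. s 0 \<in> X \<Longrightarrow> (\<And>i. 0 < i \<Longrightarrow> i < n \<Longrightarrow> s i = Leaf) \<Longrightarrow>
      \<exists>t. exec c s t (s(0 := f (s 0))) \<and> t \<le> b (size (s 0))"
  shows "ptime_on X f"
proof -
  obtain p where "\<forall>n. b n \<le> poly p n"
    using assms(1) unfolding poly_bounded_def by auto
  then have "realizes X f c n p"
    unfolding realizes_def using assms(3) by (meson order_trans)
  then show ?thesis using assms(2) unfolding ptime_on_def by blast
qed

lemma ptime_on_size:
  assumes "ptime_on X f"
  obtains b where "poly_bounded b" "mono b" "\<And>x. x \<in> X \<Longrightarrow> size (f x) \<le> b (size x)"
proof -
  obtain c n p where r: "realizes X f c n p" "0 < n" using assms unfolding ptime_on_def by blast
  have "size (f x) \<le> size x + poly p (size x)" if "x \<in> X" for x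
    by (rule realizesD[OF r(1), of "init_store x"]) (use that in \<open>auto simp: init_store_def\<close>)
  moreover have "mono (\<lambda>n. n + poly p n)"
    by (intro monoI add_mono poly_nat_mono)
  moreover have "poly_bounded (\<lambda>n. n + poly p n)"
    by (intro poly_bounded_intros)
  ultimately show thesis using that[of "\<lambda>n. n + poly p n"] by blast
qed

section \<open>Basic functions; closure under composition, pairing, branching and iteration\<close>

lemma ptime_on_id: "ptime_on X (\<lambda>x. x)"
proof (rule ptime_onI[of "\<lambda>n. 1" 1 _ Skip])
  fix s :: store
  show "\<exists>t. exec Skip s t (s(0 := s 0)) \<and> t \<le> 1"
    using exec.Skip[of s] by auto
qed (intro poly_bounded_intros | simp)+

lemma ptime_on_leaf: "ptime_on X (\<lambda>x. Leaf)"
proof (rule ptime_onI[of "\<lambda>n. 2" 1 _ "Assign 0 Nil_exp"])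
  fix s :: store
  show "\<exists>t. exec (Assign 0 Nil_exp) s t (s(0 := Leaf)) \<and> t \<le> 2"
    using exec.Assign[of 0 Nil_exp s] by auto
qed (intro poly_bounded_intros | simp)+

lemma ptime_on_comp:
  assumes f: "ptime_on X f" and g: "ptime_on Y g" and sub: "\<And>x. x \<in> X \<Longrightarrow> f x \<in> Y"
  shows "ptime_on X (\<lambda>x. g (f x))"
proof -
  obtain cf nf pf where rf: "realizes X f cf nf pf" "0 < nf"
    using f unfolding ptime_on_def by blast
  obtain cg ng pg where rg: "realizes Y g cg ng pg"
    using g unfolding ptime_on_def by blast
  show ?thesis
  proof (rule ptime_onI[of "\<lambda>n. poly pf n + poly pg (n + poly pf n)" "nf + ng" _ "Seq cf cg"])
    fix s assume s: "s 0 \<in> X" "\<And>i. 0 < i \<Longrightarrow> i < nf + ng \<Longrightarrow> s i = Leaf"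
    obtain t1 where t1: "exec cf s t1 (s(0 := f (s 0)))" "t1 \<le> poly pf (size (s 0))"
      and sz: "size (f (s 0)) \<le> size (s 0) + poly pf (size (s 0))"
      by (rule realizesD[OF rf(1), of s]) (use s in auto)
    obtain t2 where t2: "exec cg (s(0 := f (s 0))) t2 (s(0 := g (f (s 0))))"
      "t2 \<le> poly pg (size (f (s 0)))"
      by (rule realizesD[OF rg, of "s(0 := f (s 0))"]) (use s sub in auto)
    have "t2 \<le> poly pg (size (s 0) + poly pf (size (s 0)))"
      using t2(2) poly_nat_mono[OF sz, of pg] by linarith
    then show "\<exists>t. exec (Seq cf cg) s t (s(0 := g (f (s 0)))) \<and>
        t \<le> poly pf (size (s 0)) + poly pg (size (s 0) + poly pf (size (s 0)))"
      using exec.Seq[OF t1(1) t2(1)] t1(2) by (intro exI[of _ "t1 + t2"]) auto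
  qed (use rf in \<open>(intro poly_bounded_intros | simp)+\<close>)
qed

lemma ptime_on_comp_UNIV:
  "ptime_on UNIV g \<Longrightarrow> ptime_on X f \<Longrightarrow> ptime_on X (\<lambda>x. g (f x))"
  by (rule ptime_on_comp) auto

lemma ptime_on_left: "ptime_on X f \<Longrightarrow> ptime_on X (\<lambda>x. left (f x))"
proof (rule ptime_on_comp_UNIV[of left])
  show "ptime_on UNIV left"
  proof (rule ptime_onI[of "\<lambda>n. 3 + n" 1 _ "Assign 0 (Left_exp (Var 0))"])
    fix s :: store
    show "\<exists>t. exec (Assign 0 (Left_exp (Var 0))) s t (s(0 := left (s 0))) \<and> t \<le> 3 + size (s 0)"
      using exec.Assign[of 0 "Left_exp (Var 0)" s] by auto
  qed (intro poly_bounded_intros | simp)+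
qed

lemma ptime_on_right: "ptime_on X f \<Longrightarrow> ptime_on X (\<lambda>x. right (f x))"
proof (rule ptime_on_comp_UNIV[of right])
  show "ptime_on UNIV right"
  proof (rule ptime_onI[of "\<lambda>n. 3 + n" 1 _ "Assign 0 (Right_exp (Var 0))"])
    fix s :: store
    show "\<exists>t. exec (Assign 0 (Right_exp (Var 0))) s t (s(0 := right (s 0))) \<and> t \<le> 3 + size (s 0)"
      using exec.Assign[of 0 "Right_exp (Var 0)" s] by auto
  qed (intro poly_bounded_intros | simp)+
qed

lemma ptime_on_node:
  assumes f: "ptime_on X f" and g: "ptime_on X g"
  shows "ptime_on X (\<lambda>x. Node (f x) (g x))"
proof -
  obtain cf nf pf where rf: "realizes X f cf nf pf" "0 < nf"
    using f unfolding ptime_on_def by blast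
  obtain cg ng pg where rg: "realizes X g cg ng pg"
    using g unfolding ptime_on_def by blast
  \<comment> \<open>Register \<open>m\<close> keeps the input and \<open>m + 1\<close> the value of
    \<open>f\<close>. Both lie beyond the registers that the two subprograms need empty, so they
    survive the calls.\<close>
  define m where "m = nf + ng"
  have m: "0 < m" "nf \<le> m" "ng \<le> m" using rf m_def by auto
  define c where "c = Seq (Assign m (Var 0)) (Seq cf (Seq (Assign (m + 1) (Var 0))
    (Seq (Assign 0 (Var m)) (Seq (Assign m Nil_exp) (Seq cg
    (Seq (Assign 0 (Cons_exp (Var (m + 1)) (Var 0))) (Assign (m + 1) Nil_exp)))))))"
  show ?thesis
  proof (rule ptime_onI[of "\<lambda>n. 20 + 5 * n + 5 * poly pf n + 5 * poly pg n" "m + 2" _ c])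
    fix s assume s: "s 0 \<in> X" "\<And>i. 0 < i \<Longrightarrow> i < m + 2 \<Longrightarrow> s i = Leaf"
    let ?x = "s 0"
    note sl = s(2)[of m] s(2)[of "m + 1"]
    have 1: "exec (Assign m (Var 0)) s (2 + size ?x) (s(m := ?x))"
      using exec.Assign[of m "Var 0" s] by simp
    obtain t1 where t1: "exec cf (s(m := ?x)) t1 (s(m := ?x, 0 := f ?x))" "t1 \<le> poly pf (size ?x)"
      and szf: "size (f ?x) \<le> size ?x + poly pf (size ?x)"
      by (rule realizesD[OF rf(1), of "s(m := ?x)"]) (use s m in auto)
    have 2: "exec (Assign (m + 1) (Var 0)) (s(m := ?x, 0 := f ?x)) (2 + size (f ?x))
        (s(m := ?x, 0 := f ?x, m + 1 := f ?x))"
      using exec.Assign[of "m + 1" "Var 0" "s(m := ?x, 0 := f ?x)"] by simp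
    have 3: "exec (Assign 0 (Var m)) (s(m := ?x, 0 := f ?x, m + 1 := f ?x)) (2 + size ?x)
        (s(m := ?x, m + 1 := f ?x))"
      using exec.Assign[of 0 "Var m" "s(m := ?x, 0 := f ?x, m + 1 := f ?x)"] m
      by (simp add: fun_upd_twist)
    have "s(m := ?x, m + 1 := f ?x, m := Leaf) = s(m + 1 := f ?x)"
      using sl m by (auto simp: fun_eq_iff)
    then have 4: "exec (Assign m Nil_exp) (s(m := ?x, m + 1 := f ?x)) 2 (s(m + 1 := f ?x))"
      using exec.Assign[of m Nil_exp "s(m := ?x, m + 1 := f ?x)"] by (simp add: numeral_2_eq_2)
    obtain t2 where t2: "exec cg (s(m + 1 := f ?x)) t2 (s(m + 1 := f ?x, 0 := g ?x))"
      "t2 \<le> poly pg (size ?x)"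
      and szg: "size (g ?x) \<le> size ?x + poly pg (size ?x)"
      by (rule realizesD[OF rg(1), of "s(m + 1 := f ?x)"]) (use s m in auto)
    have 5: "exec (Assign 0 (Cons_exp (Var (m + 1)) (Var 0))) (s(m + 1 := f ?x, 0 := g ?x))
      (4 + size (f ?x) + size (g ?x)) (s(m + 1 := f ?x, 0 := Node (f ?x) (g ?x)))"
      using exec.Assign[of 0 "Cons_exp (Var (m + 1)) (Var 0)" "s(m + 1 := f ?x, 0 := g ?x)"]
      by (simp add: eval_nat_numeral)
    have "s(m + 1 := f ?x, 0 := Node (f ?x) (g ?x), m + 1 := Leaf) = s(0 := Node (f ?x) (g ?x))"
      using sl m by (auto simp: fun_eq_iff)
    then have 6: "exec (Assign (m + 1) Nil_exp) (s(m + 1 := f ?x, 0 := Node (f ?x) (g ?x))) 2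
      (s(0 := Node (f ?x) (g ?x)))"
      using exec.Assign[of "m + 1" Nil_exp "s(m + 1 := f ?x, 0 := Node (f ?x) (g ?x))"]
      by (simp add: numeral_2_eq_2)
    note e = exec.Seq[OF 1 exec.Seq[OF t1(1) exec.Seq[OF 2 exec.Seq[OF 3 exec.Seq[OF 4
      exec.Seq[OF t2(1) exec.Seq[OF 5 6]]]]]]]
    show "\<exists>t. exec c s t (s(0 := Node (f ?x) (g ?x))) \<and>
        t \<le> 20 + 5 * size ?x + 5 * poly pf (size ?x) + 5 * poly pg (size ?x)"
      unfolding c_def using e t1(2) t2(2) szf szg by (intro exI conjI) (assumption, linarith)
  qed (intro poly_bounded_intros | simp)+
qed

lemma ptime_on_if:
  assumes f: "ptime_on X f" and g: "ptime_on X g" and h: "ptime_on X h"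
  shows "ptime_on X (\<lambda>x. if f x = Leaf then h x else g x)"
proof -
  obtain cf nf pf where rf: "realizes X f cf nf pf" "0 < nf"
    using f unfolding ptime_on_def by blast
  obtain cg ng pg where rg: "realizes X g cg ng pg"
    using g unfolding ptime_on_def by blast
  obtain ch nh ph where rh: "realizes X h ch nh ph"
    using h unfolding ptime_on_def by blast
  define m where "m = nf + ng + nh"
  have m: "0 < m" "nf \<le> m" "ng \<le> m" "nh \<le> m" using rf m_def by auto
  \<comment> \<open>The test value is erased inside each branch, so that both branches start again
    from the original store.\<close>
  define c where "c = Seq (Assign m (Var 0)) (Seq cf (Seq (Assign (m + 1) (Var 0))
    (Seq (Assign 0 (Var m)) (Seq (Assign m Nil_exp) (Cond (Var (m + 1))
      (Seq (Assign (m + 1) Nil_exp) cg) (Seq (Assign (m + 1) Nil_exp) ch))))))"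
  show ?thesis
  proof (rule ptime_onI[of "\<lambda>n. 20 + 5 * n + 5 * poly pf n + poly pg n + poly ph n" "m + 2" _ c])
    fix s assume s: "s 0 \<in> X" "\<And>i. 0 < i \<Longrightarrow> i < m + 2 \<Longrightarrow> s i = Leaf"
    let ?x = "s 0"
    note sl = s(2)[of m] s(2)[of "m + 1"]
    have 1: "exec (Assign m (Var 0)) s (2 + size ?x) (s(m := ?x))"
      using exec.Assign[of m "Var 0" s] by simp
    obtain t1 where t1: "exec cf (s(m := ?x)) t1 (s(m := ?x, 0 := f ?x))" "t1 \<le> poly pf (size ?x)"
      and szf: "size (f ?x) \<le> size ?x + poly pf (size ?x)"
      by (rule realizesD[OF rf(1), of "s(m := ?x)"]) (use s m in auto)
    have 2: "exec (Assign (m + 1) (Var 0)) (s(m := ?x, 0 := f ?x)) (2 + size (f ?x))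
        (s(m := ?x, 0 := f ?x, m + 1 := f ?x))"
      using exec.Assign[of "m + 1" "Var 0" "s(m := ?x, 0 := f ?x)"] by simp
    have 3: "exec (Assign 0 (Var m)) (s(m := ?x, 0 := f ?x, m + 1 := f ?x)) (2 + size ?x)
        (s(m := ?x, m + 1 := f ?x))"
      using exec.Assign[of 0 "Var m" "s(m := ?x, 0 := f ?x, m + 1 := f ?x)"] m
      by (simp add: fun_upd_twist)
    have "s(m := ?x, m + 1 := f ?x, m := Leaf) = s(m + 1 := f ?x)"
      using sl m by (auto simp: fun_eq_iff)
    then have 4: "exec (Assign m Nil_exp) (s(m := ?x, m + 1 := f ?x)) 2 (s(m + 1 := f ?x))"
      using exec.Assign[of m Nil_exp "s(m := ?x, m + 1 := f ?x)"] by (simp add: numeral_2_eq_2)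
    have "s(m + 1 := f ?x, m + 1 := Leaf) = s"
      using sl m by (auto simp: fun_eq_iff)
    then have 5: "exec (Assign (m + 1) Nil_exp) (s(m + 1 := f ?x)) 2 s"
      using exec.Assign[of "m + 1" Nil_exp "s(m + 1 := f ?x)"] by (simp add: numeral_2_eq_2)
    obtain t2 where t2: "exec cg s t2 (s(0 := g ?x))" "t2 \<le> poly pg (size ?x)"
      by (rule realizesD[OF rg(1), of s]) (use s m in auto)
    obtain t3 where t3: "exec ch s t3 (s(0 := h ?x))" "t3 \<le> poly ph (size ?x)"
      by (rule realizesD[OF rh(1), of s]) (use s m in auto)
    have 6: "\<exists>t. exec (Cond (Var (m + 1)) (Seq (Assign (m + 1) Nil_exp) cg)
          (Seq (Assign (m + 1) Nil_exp) ch)) (s(m + 1 := f ?x)) t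
        (s(0 := if f ?x = Leaf then h ?x else g ?x)) \<and>
        t \<le> 5 + size (f ?x) + poly pg (size ?x) + poly ph (size ?x)"
    proof (cases "f ?x = Leaf")
      case True
      then show ?thesis
        using exec.CondFalse[OF _ exec.Seq[OF 5 t3(1)], of "Var (m + 1)"] t3(2)
        by (intro exI[of _ "1 + (1 + size (f ?x)) + (2 + t3)"]) simp
    next
      case False
      then show ?thesis
        using exec.CondTrue[OF _ exec.Seq[OF 5 t2(1)], of "Var (m + 1)"] t2(2)
        by (intro exI[of _ "1 + (1 + size (f ?x)) + (2 + t2)"]) simp
    qed
    then obtain t4 where 6: "exec (Cond (Var (m + 1)) (Seq (Assign (m + 1) Nil_exp) cg)
          (Seq (Assign (m + 1) Nil_exp) ch)) (s(m + 1 := f ?x)) t4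
        (s(0 := if f ?x = Leaf then h ?x else g ?x))"
        "t4 \<le> 5 + size (f ?x) + poly pg (size ?x) + poly ph (size ?x)"
      by blast
    note e = exec.Seq[OF 1 exec.Seq[OF t1(1) exec.Seq[OF 2 exec.Seq[OF 3 exec.Seq[OF 4 6(1)]]]]]
    show "\<exists>t. exec c s t (s(0 := if f ?x = Leaf then h ?x else g ?x)) \<and>
        t \<le> 20 + 5 * size ?x + 5 * poly pf (size ?x) + poly pg (size ?x) + poly ph (size ?x)"
      unfolding c_def using e 6(2) t1(2) szf by (intro exI conjI) (assumption, linarith)
  qed (intro poly_bounded_intros | simp)+
qed

text \<open>Polynomially many rounds of a polynomial-time step may build exponentially large trees,
  so a bound \<open>m\<close> on every state visited accompanies the bound \<open>k\<close> on the
  number of rounds. The left subtree of a state controls the loop.\<close>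

inductive runs :: "(tree \<Rightarrow> tree) \<Rightarrow> nat \<Rightarrow> nat \<Rightarrow> tree \<Rightarrow> tree \<Rightarrow> bool"
  for g :: "tree \<Rightarrow> tree" and m :: nat where
  stop: "left x = Leaf \<Longrightarrow> size x \<le> m \<Longrightarrow> runs g m k x x"
| step: "left x \<noteq> Leaf \<Longrightarrow> size x \<le> m \<Longrightarrow> runs g m k (g x) y \<Longrightarrow> runs g m (Suc k) x y"

lemma ptime_on_iterate:
  assumes i: "ptime_on X i" and g: "ptime_on UNIV g" and "poly_bounded a" "poly_bounded b"
    and r: "\<And>x. x \<in> X \<Longrightarrow> runs g (a (size x)) (b (size x)) (i x) (f x)"
  shows "ptime_on X f"
proof -
  obtain c n p where rg: "realizes UNIV g c n p"
    using g unfolding ptime_on_def by blast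
  obtain ci ni q where ri: "realizes X i ci ni q" "0 < ni"
    using i unfolding ptime_on_def by blast
  let ?w = "While (Left_exp (Var 0)) c"
  have loop: "\<exists>t. exec ?w s t (s(0 := y)) \<and> t \<le> Suc k * (3 + m + poly p m)"
    if "runs g m k x y" "s 0 = x" "\<And>i. 0 < i \<Longrightarrow> i < n \<Longrightarrow> s i = Leaf" for m k x y s
    using that
  proof (induction arbitrary: s)
    case (stop x k)
    then have "s(0 := x) = s" by auto
    then show ?case using stop exec.WhileFalse[of "Left_exp (Var 0)" s c]
      by (intro exI conjI) auto
  next
    case (step x k y)
    obtain t1 where t1: "exec c s t1 (s(0 := g x))" "t1 \<le> poly p (size x)"
      by (rule realizesD[OF rg, of s]) (use step in auto)
    obtain t2 where t2: "exec ?w (s(0 := g x)) t2 (s(0 := y))"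
      "t2 \<le> Suc k * (3 + m + poly p m)"
      using step.IH[of "s(0 := g x)"] step.prems by (metis fun_upd_apply fun_upd_upd nat_neq_iff)
    have "t1 \<le> poly p m" using t1(2) poly_nat_mono[OF step.hyps(2), of p] by linarith
    moreover have "exec ?w s (1 + cost (Left_exp (Var 0)) s + t1 + t2) (s(0 := y))"
      using exec.WhileTrue[OF _ t1(1) t2(1)] step.hyps step.prems by simp
    moreover have "1 + cost (Left_exp (Var 0)) s + t1 + t2 \<le> Suc (Suc k) * (3 + m + poly p m)"
      using calculation(1) t2(2) step.hyps(2) step.prems(1) by simp
    ultimately show ?case by blast
  qed
  show ?thesis
  proof (rule ptime_onI[of "\<lambda>n. poly q n + (1 + b n) * (3 + a n + poly p (a n))" "ni + n" _ "Seq ci ?w"])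
    show "poly_bounded (\<lambda>n. poly q n + (1 + b n) * (3 + a n + poly p (a n)))"
      using assms by (intro poly_bounded_intros)
    fix s assume s: "s 0 \<in> X" "\<And>i. 0 < i \<Longrightarrow> i < ni + n \<Longrightarrow> s i = Leaf"
    obtain t1 where t1: "exec ci s t1 (s(0 := i (s 0)))" "t1 \<le> poly q (size (s 0))"
      by (rule realizesD[OF ri(1), of s]) (use s in auto)
    have "\<exists>t. exec ?w (s(0 := i (s 0))) t (s(0 := i (s 0), 0 := f (s 0))) \<and>
        t \<le> Suc (b (size (s 0))) * (3 + a (size (s 0)) + poly p (a (size (s 0))))"
      by (rule loop[OF r[OF s(1)]]) (use s(2) in auto)
    then obtain t2 where t2: "exec ?w (s(0 := i (s 0))) t2 (s(0 := f (s 0)))"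
      "t2 \<le> Suc (b (size (s 0))) * (3 + a (size (s 0)) + poly p (a (size (s 0))))"
      unfolding fun_upd_upd by blast
    show "\<exists>t. exec (Seq ci ?w) s t (s(0 := f (s 0))) \<and>
        t \<le> poly q (size (s 0)) + (1 + b (size (s 0))) * (3 + a (size (s 0)) + poly p (a (size (s 0))))"
      using exec.Seq[OF t1(1) t2(1)] t1(2) t2(2) by (intro exI[of _ "t1 + t2"]) simp
  qed (use ri in simp)
qed

section \<open>Passing between solvable problems and polynomial-time functions\<close>

lemma exec_clear:
  "\<exists>c. \<forall>s. exec c s (1 + 2 * k) (\<lambda>i. if 0 < i \<and> i \<le> k then Leaf else s i)"
proof (induction k)
  case 0
  have "(\<lambda>i. if 0 < i \<and> i \<le> 0 then Leaf else s i) = s" for s :: store by auto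
  then show ?case using exec.Skip by auto
next
  case (Suc k)
  then obtain c where c: "\<And>s. exec c s (1 + 2 * k) (\<lambda>i. if 0 < i \<and> i \<le> k then Leaf else s i)"
    by blast
  have "exec (Seq c (Assign (Suc k) Nil_exp)) s (1 + 2 * Suc k)
     (\<lambda>i. if 0 < i \<and> i \<le> Suc k then Leaf else s i)" for s
  proof -
    let ?r = "(\<lambda>i. if 0 < i \<and> i \<le> k then Leaf else s i)"
    have "?r(Suc k := Leaf) = (\<lambda>i. if 0 < i \<and> i \<le> Suc k then Leaf else s i)"
      by (auto simp: fun_eq_iff)
    then show ?thesis
      using exec.Seq[OF c[of s] exec.Assign[of "Suc k" Nil_exp ?r]] by simp
  qed
  then show ?case by blast
qed

lemma ptime_on_of_solvable:
  assumes "poly_time_solvable enc_in enc_out valid sol"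
  obtains f where "ptime_on (enc_in ` Collect valid) f"
    "\<And>x. valid x \<Longrightarrow> \<exists>y. f (enc_in x) = enc_out y \<and> sol x y"
proof -
  obtain c and p :: "nat poly" where c: "\<And>x. valid x \<Longrightarrow>
      \<exists>t s y. exec c (init_store (enc_in x)) t s \<and> t \<le> poly p (size (enc_in x)) \<and>
        s 0 = enc_out y \<and> sol x y"
    using assms unfolding poly_time_solvable_def by blast
  \<comment> \<open>Determinism makes the final store unique, so the choice is the actual output
    wherever the program terminates.\<close>
  define f where "f = (\<lambda>x. (SOME s. \<exists>t. exec c (init_store x) t s) 0)"
  have f: "f x = s 0" if "exec c (init_store x) t s" for x t s
  proof -
    have "(SOME s. \<exists>t. exec c (init_store x) t s) = s"
      using that exec_deterministic by (intro some_equality) blast+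
    then show ?thesis unfolding f_def by simp
  qed
  obtain k where k: "com_regs c \<subseteq> {..k}"
    using finite_com_regs[of c] finite_nat_iff_bounded_le by auto
  \<comment> \<open>The solver may leave anything in its registers; they are emptied afterwards to
    meet \<open>realizes\<close>.\<close>
  obtain c' where c': "\<And>s. exec c' s (1 + 2 * k) (\<lambda>i. if 0 < i \<and> i \<le> k then Leaf else s i)"
    using exec_clear by blast
  have "ptime_on (enc_in ` Collect valid) f"
  proof (rule ptime_onI[of "\<lambda>n. poly p n + (1 + 2 * k)" "Suc k" _ "Seq c c'"])
    fix s assume s: "s 0 \<in> enc_in ` Collect valid" "\<And>i. 0 < i \<Longrightarrow> i < Suc k \<Longrightarrow> s i = Leaf"
    then obtain t s' where e: "exec c (init_store (s 0)) t s'" and t: "t \<le> poly p (size (s 0))"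
      using c by (metis imageE mem_Collect_eq)
    let ?r = "\<lambda>i. if i \<in> {..k} then s' i else s i"
    have "exec c s t ?r"
      by (rule exec_frame[OF e k]) (use s in \<open>auto simp: init_store_def\<close>)
    note e2 = exec.Seq[OF this c'[of ?r]]
    have "(\<lambda>i. if 0 < i \<and> i \<le> k then Leaf else ?r i) = s(0 := f (s 0))"
      using f[OF e] s by (auto simp: fun_eq_iff)
    with e2 t show "\<exists>t. exec (Seq c c') s t (s(0 := f (s 0))) \<and> t \<le> poly p (size (s 0)) + (1 + 2 * k)"
      by (intro exI[of _ "t + (1 + 2 * k)"]) auto
  qed (intro poly_bounded_intros | simp)+
  moreover have "\<exists>y. f (enc_in x) = enc_out y \<and> sol x y" if "valid x" for x
    using c[OF that] f by metis
  ultimately show thesis using that by blast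
qed

lemma solvable_of_ptime_on:
  assumes "ptime_on (enc_in ` Collect valid) f"
    and "\<And>x. valid x \<Longrightarrow> \<exists>y. f (enc_in x) = enc_out y \<and> sol x y"
  shows "poly_time_solvable enc_in enc_out valid sol"
proof -
  obtain c n p where r: "realizes (enc_in ` Collect valid) f c n p" "0 < n"
    using assms(1) unfolding ptime_on_def by blast
  show ?thesis
    unfolding poly_time_solvable_def
  proof (rule exI[of _ c], rule exI[of _ p], intro allI impI)
    fix x assume x: "valid x"
    obtain t where t: "exec c (init_store (enc_in x)) t ((init_store (enc_in x))(0 := f (enc_in x)))"
      "t \<le> poly p (size (enc_in x))"
      by (rule realizesD[OF r(1), of "init_store (enc_in x)"])
        (use x in \<open>auto simp: init_store_def\<close>)
    then show "\<exists>t s y. exec c (init_store (enc_in x)) t s \<and> t \<le> poly p (size (enc_in x)) \<and>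
        s 0 = enc_out y \<and> sol x y"
      using assms(2)[OF x] by (metis fun_upd_same)
  qed
qed

section \<open>Lists coded as trees\<close>

lemma ptime_on_const: "ptime_on X (\<lambda>x. t)"
  by (induction t) (auto intro: ptime_on_leaf ptime_on_node)

lemma runs_mono: "runs g m k x y \<Longrightarrow> k \<le> k' \<Longrightarrow> runs g m k' x y"
proof (induction arbitrary: k' rule: runs.induct)
  case (step x k y)
  then obtain j where "k' = Suc j" "k \<le> j" by (cases k') auto
  then show ?case using step by (auto intro: runs.step)
qed (auto intro: runs.stop)

text \<open>
  A tree doubles as the list of left subtrees along its right spine, so that list functions are
  defined by structural recursion on the right subtree.
\<close>

fun trevapp :: "tree \<Rightarrow> tree \<Rightarrow> tree" where
  "trevapp a Leaf = a"
| "trevapp a (Node h t) = trevapp (Node h a) t"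

definition trev :: "tree \<Rightarrow> tree" where
  "trev l = trevapp Leaf l"

text \<open>The list to recurse on comes last, as in \<open>ptime_on_rec\<close>; hence
  \<open>tapp a l\<close> is \<open>l\<close> followed by \<open>a\<close>.\<close>

fun tapp :: "tree \<Rightarrow> tree \<Rightarrow> tree" where
  "tapp a Leaf = a"
| "tapp a (Node h t) = Node h (tapp a t)"

lemma tapp_Leaf: "tapp Leaf l = l"
  by (induction l) auto

text \<open>The two accumulators are for the induction; with both empty this gives the double
  reversal in \<open>trev_trev\<close>.\<close>

lemma trevapp_trevapp: "trevapp a (trevapp b l) = trevapp (tapp a l) b"
  by (induction b l arbitrary: a rule: trevapp.induct) auto

lemma trev_trev: "trevapp Leaf (trev l) = l"
  unfolding trev_def trevapp_trevapp by (simp add: tapp_Leaf)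

lemma size_trevapp: "size (trevapp a l) = size a + size l"
  by (induction a l rule: trevapp.induct) auto

lemma ptime_on_trev:
  assumes "ptime_on X f"
  shows "ptime_on X (\<lambda>x. trev (f x))"
proof (rule ptime_on_comp_UNIV[OF _ assms])
  let ?g = "\<lambda>y. Node (right (left y)) (Node (left (left y)) (right y))"
  have run: "size l + size a < m \<Longrightarrow> runs ?g m (size l) (Node l a) (Node Leaf (trevapp a l))" for m l a
  proof (induction a l rule: trevapp.induct)
    case (2 a h t)
    then have "runs ?g m (size t) (?g (Node (Node h t) a)) (Node Leaf (trevapp (Node h a) t))"
      by simp
    then have "runs ?g m (Suc (size t)) (Node (Node h t) a) (Node Leaf (trevapp (Node h a) t))"
      using 2 by (intro runs.step) auto
    then show ?case using runs_mono by fastforce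
  qed (auto intro: runs.stop)
  have "ptime_on UNIV (\<lambda>x. Node Leaf (trevapp Leaf x))"
  proof (rule ptime_on_iterate)
    show "ptime_on UNIV (\<lambda>x. Node x Leaf)" "ptime_on UNIV ?g"
      by (intro ptime_on_id ptime_on_node ptime_on_leaf ptime_on_left ptime_on_right)+
    show "runs ?g (1 + size x) (size x) (Node x Leaf) (Node Leaf (trevapp Leaf x))" for x
      by (rule run) simp
  qed (intro poly_bounded_intros)+
  from ptime_on_right[OF this] show "ptime_on UNIV trev" by (simp add: trev_def[abs_def])
qed

text \<open>
  List recursion is computed from the end of the list: the loop stores a suffix of the list together
  with the value of the function at this suffix.
\<close>

lemma ptime_on_rec:
  assumes F_Leaf: "\<And>c. F c Leaf = z c"
    and F_Node: "\<And>c h t. F c (Node h t) = g (Node c (Node h (Node t (F c t))))"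
    and z: "ptime_on UNIV z" and g: "ptime_on UNIV g"
    and b: "poly_bounded b" and size_F: "\<And>c l. size (F c l) \<le> b (size c + size l)"
    and a: "ptime_on X a" and l: "ptime_on X l"
  shows "ptime_on X (\<lambda>x. F (a x) (l x))"
proof -
  obtain p where p: "\<And>n. b n \<le> poly p n" using b unfolding poly_bounded_def by blast
  \<comment> \<open>A state is \<open>Node r (Node c (Node t v))\<close>: \<open>r\<close> is the
    reversed part of the list still to be processed, \<open>c\<close> the parameter,
    \<open>t\<close> the suffix already processed and \<open>v\<close> the value
    \<open>F c t\<close>.\<close>
  let ?g = "\<lambda>s. Node (right (left s)) (Node (left (right s))
    (Node (Node (left (left s)) (left (right (right s))))
       (g (Node (left (right s)) (Node (left (left s)) (right (right s)))))))"
  have run: "size l + size c + size t + 3 + poly p (size c + size t + size l) \<le> m \<Longrightarrow>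
    runs ?g m (size l) (Node l (Node c (Node t (F c t))))
      (Node Leaf (Node c (Node (trevapp t l) (F c (trevapp t l)))))" for m l c t
  proof (induction t l rule: trevapp.induct)
    case (1 a)
    have "size (F c a) \<le> poly p (size c + size a)" using size_F p order_trans by blast
    then show ?case using 1 by (auto intro!: runs.stop)
  next
    case (2 a h t)
    have "size (F c a) \<le> poly p (size c + size a)" using size_F p order_trans by blast
    also have "\<dots> \<le> poly p (size c + size a + size (Node h t))" by (rule poly_nat_mono) simp
    finally have sz: "size (Node (Node h t) (Node c (Node a (F c a)))) \<le> m" using 2(2) by simp
    have "size t + size c + size (Node h a) + 3 + poly p (size c + size (Node h a) + size t) \<le> m"
      using 2(2) by (simp add: algebra_simps)
    from 2(1)[OF this] have "runs ?g m (size t) (?g (Node (Node h t) (Node c (Node a (F c a)))))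
        (Node Leaf (Node c (Node (trevapp a (Node h t)) (F c (trevapp a (Node h t))))))"
      by (simp add: F_Node)
    then have "runs ?g m (Suc (size t)) (Node (Node h t) (Node c (Node a (F c a))))
        (Node Leaf (Node c (Node (trevapp a (Node h t)) (F c (trevapp a (Node h t))))))"
      by (rule runs.step[rotated 2]) (use sz in auto)
    then show ?case by (rule runs_mono) simp
  qed
  have "ptime_on UNIV (\<lambda>y. Node Leaf (Node (left y) (Node (right y) (F (left y) (right y)))))"
  proof (rule ptime_on_iterate)
    show "ptime_on UNIV (\<lambda>y. Node (trev (right y)) (Node (left y) (Node Leaf (z (left y)))))"
      by (intro ptime_on_id ptime_on_node ptime_on_leaf ptime_on_left ptime_on_right ptime_on_trev
          ptime_on_comp_UNIV[OF z])
    show "ptime_on UNIV ?g"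
      by (intro ptime_on_id ptime_on_node ptime_on_leaf ptime_on_left ptime_on_right
          ptime_on_comp_UNIV[OF g])
    fix y
    have 1: "size (left y) + size (right y) \<le> size y" by (cases y) auto
    then have "poly p (size (left y) + size (right y)) \<le> poly p (size y)" by (rule poly_nat_mono)
    with 1 have "runs ?g (3 + size y + poly p (size y)) (size (trev (right y)))
      (Node (trev (right y)) (Node (left y) (Node Leaf (F (left y) Leaf))))
      (Node Leaf (Node (left y) (Node (trevapp Leaf (trev (right y)))
         (F (left y) (trevapp Leaf (trev (right y)))))))"
      by (intro run) (simp add: trev_def size_trevapp)
    then show "runs ?g (3 + size y + poly p (size y)) (size y)
      (Node (trev (right y)) (Node (left y) (Node Leaf (z (left y)))))
      (Node Leaf (Node (left y) (Node (right y) (F (left y) (right y)))))"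
      unfolding trev_trev F_Leaf
      by (rule runs_mono) (use 1 in \<open>simp add: trev_def size_trevapp\<close>)
  qed (intro poly_bounded_intros)+
  from ptime_on_right[OF ptime_on_right[OF ptime_on_right[OF this]]]
  have F: "ptime_on UNIV (\<lambda>y. F (left y) (right y))" by simp
  from ptime_on_comp_UNIV[OF F ptime_on_node[OF a l]] show ?thesis by simp
qed

section \<open>Boolean tests and equality of trees\<close>

lemma ptime_on_if_bool:
  assumes "ptime_on X (\<lambda>x. enc_bool (P x))" "ptime_on X g" "ptime_on X h"
  shows "ptime_on X (\<lambda>x. if P x then g x else h x)"
proof -
  have "(\<lambda>x. if P x then g x else h x) = (\<lambda>x. if enc_bool (P x) = Leaf then h x else g x)"
    by (rule ext) (metis (full_types) enc_bool.simps tree.distinct(1))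
  then show ?thesis using ptime_on_if[OF assms] by simp
qed

lemma ptime_on_bool_leaf:
  assumes "ptime_on X f" shows "ptime_on X (\<lambda>x. enc_bool (f x = Leaf))"
proof -
  have "(\<lambda>x. enc_bool (f x = Leaf)) = (\<lambda>x. if f x = Leaf then enc_bool True else enc_bool False)"
    by auto
  then show ?thesis using ptime_on_if[OF assms ptime_on_const ptime_on_const] by metis
qed

lemma ptime_on_bool_not:
  assumes "ptime_on X (\<lambda>x. enc_bool (P x))"
  shows "ptime_on X (\<lambda>x. enc_bool (\<not> P x))"
proof -
  have "(\<lambda>x. enc_bool (\<not> P x)) = (\<lambda>x. if P x then enc_bool False else enc_bool True)"
    by auto
  then show ?thesis using ptime_on_if_bool[OF assms ptime_on_const ptime_on_const] by metis
qed

lemma ptime_on_bool_and: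
  assumes "ptime_on X (\<lambda>x. enc_bool (P x))" "ptime_on X (\<lambda>x. enc_bool (Q x))"
  shows "ptime_on X (\<lambda>x. enc_bool (P x \<and> Q x))"
proof -
  have "(\<lambda>x. enc_bool (P x \<and> Q x)) = (\<lambda>x. if P x then enc_bool (Q x) else enc_bool False)"
    by auto
  then show ?thesis using ptime_on_if_bool[OF assms ptime_on_const] by metis
qed

lemma ptime_on_bool_or:
  assumes "ptime_on X (\<lambda>x. enc_bool (P x))" "ptime_on X (\<lambda>x. enc_bool (Q x))"
  shows "ptime_on X (\<lambda>x. enc_bool (P x \<or> Q x))"
  using ptime_on_bool_not[OF ptime_on_bool_and[OF ptime_on_bool_not[OF assms(1)]
    ptime_on_bool_not[OF assms(2)]]] by simp

lemma enc_list_id: "enc_list f xs = enc_list (\<lambda>x. x) (map f xs)"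
  by (induction xs) auto

text \<open>Equality descends into both subtrees and so is no list recursion. The loop keeps a stack
  of pairs still to be compared and a flag; a mismatch jumps to \<open>Leaf\<close>, which reads as
  an empty stack with flag false.\<close>

lemma ptime_on_bool_eq:
  assumes "ptime_on X f" "ptime_on X f'"
  shows "ptime_on X (\<lambda>x. enc_bool (f x = f' x))"
proof -
  let ?push = "\<lambda>a b. Node (Node (left a) (left b)) (Node (Node (right a) (right b)) Leaf)"
  define g where "g = (\<lambda>s. if left (left (left s)) = Leaf
    then if right (left (left s)) = Leaf then Node (right (left s)) (right s) else Leaf
    else if right (left (left s)) = Leaf then Leaf
    else Node (Node (Node (left (left (left (left s)))) (left (right (left (left s)))))
      (Node (Node (right (left (left (left s)))) (right (right (left (left s)))))
        (right (left s)))) (right s))"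
  let ?stack = "enc_list (\<lambda>(a, b). Node a b)"
  \<comment> \<open>Splitting a pair of nodes lowers the total weight \<open>2 * size a + 1\<close>
    over the stack by one and leaves the size of the state unchanged.\<close>
  have run: "sum_list (map (\<lambda>(a, b). 2 * size a + 1) ps) \<le> k \<Longrightarrow>
     size (Node (?stack ps) (enc_bool True)) \<le> m \<Longrightarrow>
     \<exists>r. runs g m k (Node (?stack ps) (enc_bool True)) r \<and>
      right r = enc_bool (\<forall>(a, b) \<in> set ps. a = b)" for k m ps
  proof (induction k arbitrary: ps)
    case 0
    then have "ps = []" by (cases ps) auto
    with 0 show ?case by (intro exI[of _ "Node Leaf (enc_bool True)"]) (auto intro: runs.stop)
  next
    case (Suc k)
    show ?case
    proof (cases ps)
      case Nil
      with Suc show ?thesis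
        by (intro exI[of _ "Node Leaf (enc_bool True)"]) (auto intro: runs.stop)
    next
      case (Cons p qs)
      obtain a b where p: "p = (a, b)" by force
      let ?s = "Node (?stack ps) (enc_bool True)"
      have left: "left ?s \<noteq> Leaf" using Cons p by simp
      show ?thesis
      proof (cases a)
        case a: Leaf
        show ?thesis
        proof (cases b)
          case Leaf
          have "\<exists>r. runs g m k (Node (?stack qs) (enc_bool True)) r \<and>
              right r = enc_bool (\<forall>(a, b) \<in> set qs. a = b)"
            by (rule Suc.IH) (use Suc.prems Cons p in auto)
          moreover have "g ?s = Node (?stack qs) (enc_bool True)"
            using Cons p a Leaf by (simp add: g_def)
          ultimately show ?thesis using runs.step[OF left Suc.prems(2), of g k] Cons p a Leaf by auto
        next
          case (Node b1 b2)
          have gs: "g ?s = Leaf" using Cons p a Node by (simp add: g_def)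
          have "runs g m (Suc k) ?s Leaf"
            by (rule runs.step[OF left Suc.prems(2)], subst gs, rule runs.stop) auto
          then show ?thesis using Cons p a Node by (intro exI[of _ Leaf]) simp
        qed
      next
        case a: (Node a1 a2)
        show ?thesis
        proof (cases b)
          case Leaf
          have gs: "g ?s = Leaf" using Cons p a Leaf by (simp add: g_def)
          have "runs g m (Suc k) ?s Leaf"
            by (rule runs.step[OF left Suc.prems(2)], subst gs, rule runs.stop) auto
          then show ?thesis using Cons p a Leaf by (intro exI[of _ Leaf]) simp
        next
          case (Node b1 b2)
          let ?ps = "(a1, b1) # (a2, b2) # qs"
          have "\<exists>r. runs g m k (Node (?stack ?ps) (enc_bool True)) r \<and>
              right r = enc_bool (\<forall>(a, b) \<in> set ?ps. a = b)"
            by (rule Suc.IH) (use Suc.prems Cons p a Node in auto)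
          then obtain r where r: "runs g m k (Node (?stack ?ps) (enc_bool True)) r"
              "right r = enc_bool (\<forall>(a, b) \<in> set ?ps. a = b)"
            by blast
          have gs: "g ?s = Node (?stack ?ps) (enc_bool True)"
            using Cons p a Node by (simp add: g_def)
          have "runs g m (Suc k) ?s r"
            by (rule runs.step[OF left Suc.prems(2)], subst gs, rule r(1))
          moreover have "(\<forall>(a, b) \<in> set ?ps. a = b) = (\<forall>(a, b) \<in> set ps. a = b)"
            using Cons p a Node by auto
          ultimately show ?thesis using r(2) by (intro exI[of _ r]) simp
        qed
      qed
    qed
  qed
  define r where "r = (\<lambda>x. SOME r. runs g (4 + size x) (1 + 2 * size x)
     (Node (Node (Node (left x) (right x)) Leaf) (enc_bool True)) r \<and>
       right r = enc_bool (left x = right x))"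
  have r: "runs g (4 + size x) (1 + 2 * size x)
      (Node (Node (Node (left x) (right x)) Leaf) (enc_bool True)) (r x)"
    "right (r x) = enc_bool (left x = right x)" for x
  proof -
    have "size (left x) + size (right x) \<le> size x" by (cases x) auto
    then have "\<exists>r. runs g (4 + size x) (1 + 2 * size x)
        (Node (Node (Node (left x) (right x)) Leaf) (enc_bool True)) r \<and>
        right r = enc_bool (left x = right x)"
      using run[of "[(left x, right x)]" "1 + 2 * size x" "4 + size x"] by simp
    from someI_ex[OF this]
    show "runs g (4 + size x) (1 + 2 * size x)
      (Node (Node (Node (left x) (right x)) Leaf) (enc_bool True)) (r x)"
    "right (r x) = enc_bool (left x = right x)" unfolding r_def by blast+
  qed
  have "ptime_on UNIV r"
  proof (rule ptime_on_iterate)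
    show "runs g (4 + size x) (1 + 2 * size x)
      (Node (Node (Node (left x) (right x)) Leaf) (enc_bool True)) (r x)" for x
      by (rule r(1))
    show "ptime_on UNIV g" unfolding g_def
      by (intro ptime_on_id ptime_on_node ptime_on_leaf ptime_on_left ptime_on_right
          ptime_on_if_bool ptime_on_bool_leaf)
  qed (intro poly_bounded_intros ptime_on_id ptime_on_node ptime_on_leaf ptime_on_left
      ptime_on_right ptime_on_const)+
  from ptime_on_comp_UNIV[OF ptime_on_right[OF this] ptime_on_node[OF assms]]
  show ?thesis using r(2) by simp
qed

lemmas ptime_intros = ptime_on_id ptime_on_const ptime_on_node ptime_on_left ptime_on_right
  ptime_on_if_bool ptime_on_bool_eq ptime_on_bool_not ptime_on_bool_and ptime_on_bool_or

section \<open>Unary arithmetic on list lengths and conversion to binary\<close>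

fun spine :: "tree \<Rightarrow> nat" where
  "spine Leaf = 0"
| "spine (Node h t) = Suc (spine t)"

fun tree_list :: "tree \<Rightarrow> tree list" where
  "tree_list Leaf = []"
| "tree_list (Node h t) = h # tree_list t"

lemma length_tree_list: "length (tree_list t) = spine t"
  by (induction t) auto

lemma enc_tree_list: "enc_list f (tree_list t) = enc_list (\<lambda>x. x) (map f (tree_list t))"
  by (induction t) auto

lemma spine_le_size: "spine t \<le> size t"
  by (induction t) auto

text \<open>A linear bound is enough, since every conversion starts from a unary number.\<close>

lemma size_bits: "size (enc_list enc_bool (bits n)) \<le> 2 * n"
proof (induction n rule: bits.induct)
  case (1 n)
  show ?case
  proof (cases "n = 0")
    case False
    then have "size (enc_list enc_bool (bits n)) =
        size (enc_bool (odd n)) + size (enc_list enc_bool (bits (n div 2))) + 1"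
      by (subst bits.simps) simp
    also have "\<dots> \<le> (if odd n then 1 else 0) + 2 * (n div 2) + 1"
      using 1 False by (cases "odd n") auto
    also have "\<dots> \<le> 2 * n" using False by (cases "odd n") presburger+
    finally show ?thesis .
  qed (simp add: bits.simps)
qed

fun tinc :: "tree \<Rightarrow> tree" where
  "tinc Leaf = Node (enc_bool True) Leaf"
| "tinc (Node h t) = (if h = Leaf then Node (enc_bool True) t else Node Leaf (tinc t))"

lemma tinc_enc_nat: "tinc (enc_nat n) = enc_nat (Suc n)"
proof (induction n rule: bits.induct)
  case (1 n)
  show ?case
  proof (cases "n = 0")
    case True
    then show ?thesis by (simp add: enc_nat_def bits.simps[of 0] bits.simps[of "Suc 0"])
  next
    case False
    then have n: "enc_nat n = Node (enc_bool (odd n)) (enc_nat (n div 2))"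
      unfolding enc_nat_def by (subst bits.simps) simp
    have sn: "enc_nat (Suc n) = Node (enc_bool (even n)) (enc_nat (Suc n div 2))"
      unfolding enc_nat_def by (subst bits.simps) simp
    show ?thesis using 1 False by (cases "odd n") (auto simp: n sn)
  qed
qed

lemma size_tinc: "size (tinc t) \<le> size t + 2"
  by (induction t) auto

lemma ptime_on_tinc:
  assumes "ptime_on X f"
  shows "ptime_on X (\<lambda>x. tinc (f x))"
proof (rule ptime_on_rec[where F = "\<lambda>c. tinc"])
  show "tinc (Node h t) = (\<lambda>y. if left (right y) = Leaf then Node (enc_bool True) (left (right (right y)))
     else Node Leaf (right (right (right y)))) (Node c (Node h (Node t (tinc t))))" for c h t
    by simp
  show "size (tinc l) \<le> (size c + size l) + 2" for c l :: tree
    using size_tinc[of l] by simp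
  show "ptime_on X (\<lambda>x. Leaf)" by (intro ptime_intros)
qed (rule assms tinc.simps | intro ptime_intros poly_bounded_intros)+

fun tbin :: "tree \<Rightarrow> tree" where
  "tbin Leaf = Leaf"
| "tbin (Node h t) = tinc (tbin t)"

lemma tbin_eq: "tbin t = enc_nat (spine t)"
  by (induction t) (simp_all add: tinc_enc_nat, simp add: enc_nat_def bits.simps)

lemma ptime_on_enc_nat:
  assumes "ptime_on X f"
  shows "ptime_on X (\<lambda>x. enc_nat (spine (f x)))"
proof -
  have "ptime_on X (\<lambda>x. tbin (f x))"
  proof (rule ptime_on_rec[where F = "\<lambda>c. tbin"])
    show "tbin (Node h t) = tinc (right (right (right (Node c (Node h (Node t (tbin t)))))))" for c h t
      by simp
    show "size (tbin l) \<le> 2 * (size c + size l)" for c l :: tree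
    proof -
      have "size (tbin l) \<le> 2 * spine l" by (simp add: tbin_eq enc_nat_def size_bits)
      also have "\<dots> \<le> 2 * (size c + size l)" using spine_le_size[of l] by simp
      finally show ?thesis .
    qed
    show "ptime_on X (\<lambda>x. Leaf)" by (intro ptime_intros)
  qed (rule assms tbin.simps | intro ptime_intros poly_bounded_intros ptime_on_tinc)+
  then show ?thesis unfolding tbin_eq .
qed

lemma size_tapp: "size (tapp a l) = size a + size l"
  by (induction a l rule: tapp.induct) auto

lemma spine_tapp: "spine (tapp a l) = spine a + spine l"
  by (induction a l rule: tapp.induct) auto

lemma ptime_on_tapp:
  assumes "ptime_on X f" "ptime_on X g"
  shows "ptime_on X (\<lambda>x. tapp (f x) (g x))"
proof (rule ptime_on_rec[where F = "tapp"])
  show "tapp c (Node h t) = (\<lambda>y. Node (left (right y)) (right (right (right y))))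
     (Node c (Node h (Node t (tapp c t))))" for c h t
    by simp
  show "size (tapp c l) \<le> size c + size l" for c l
    by (simp add: size_tapp)
qed (rule assms tapp.simps | intro ptime_intros poly_bounded_intros)+

fun tmul :: "tree \<Rightarrow> tree \<Rightarrow> tree" where
  "tmul a Leaf = Leaf"
| "tmul a (Node h t) = tapp a (tmul a t)"

lemma size_tmul: "size (tmul a l) \<le> size a * size l"
  by (induction a l rule: tmul.induct) (auto simp: size_tapp algebra_simps)

lemma spine_tmul: "spine (tmul a l) = spine a * spine l"
  by (induction a l rule: tmul.induct) (auto simp: spine_tapp)

lemma ptime_on_tmul:
  assumes "ptime_on X f" "ptime_on X g"
  shows "ptime_on X (\<lambda>x. tmul (f x) (g x))"
proof (rule ptime_on_rec[where F = "tmul"])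
  show "tmul c (Node h t) = (\<lambda>y. tapp (left y) (right (right (right y))))
     (Node c (Node h (Node t (tmul c t))))" for c h t
    by simp
  show "size (tmul c l) \<le> (size c + size l) * (size c + size l)" for c l
    by (rule order_trans[OF size_tmul]) (auto intro: mult_mono)
qed (rule assms tmul.simps | intro ptime_intros poly_bounded_intros ptime_on_tapp)+

text \<open>Serves to compare lengths, and as list access: the left subtree of
  \<open>tdrop a l\<close> is the entry of \<open>a\<close> at position
  \<open>spine l\<close>.\<close>

fun tdrop :: "tree \<Rightarrow> tree \<Rightarrow> tree" where
  "tdrop a Leaf = a"
| "tdrop a (Node h t) = right (tdrop a t)"

lemma size_right: "size (right t) \<le> size t"
  by (cases t) auto

lemma size_tdrop: "size (tdrop a l) \<le> size a"
  by (induction a l rule: tdrop.induct) (auto intro: order_trans[OF size_right])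

lemma tree_list_right: "tree_list (right t) = tl (tree_list t)"
  by (cases t) auto

lemma tree_list_tdrop: "tree_list (tdrop a l) = drop (spine l) (tree_list a)"
  by (induction a l rule: tdrop.induct) (auto simp: tree_list_right drop_Suc tl_drop)

lemma ptime_on_tdrop:
  assumes "ptime_on X f" "ptime_on X g"
  shows "ptime_on X (\<lambda>x. tdrop (f x) (g x))"
proof (rule ptime_on_rec[where F = "tdrop"])
  show "tdrop c (Node h t) = (\<lambda>y. right (right (right (right y))))
     (Node c (Node h (Node t (tdrop c t))))" for c h t
    by simp
  show "size (tdrop c l) \<le> size c + size l" for c l
    by (rule order_trans[OF size_tdrop]) auto
qed (rule assms tdrop.simps | intro ptime_intros poly_bounded_intros)+

fun tmap :: "(tree \<Rightarrow> tree) \<Rightarrow> tree \<Rightarrow> tree" where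
  "tmap f Leaf = Leaf"
| "tmap f (Node h t) = Node (f h) (tmap f t)"

lemma tmap_eq: "tmap f t = enc_list f (tree_list t)"
  by (induction t) auto

text \<open>Programs have no closures, so whatever the mapped function knows besides the element is
  handed over as the tree \<open>a x\<close>.\<close>

lemma ptime_on_tmap:
  assumes f: "ptime_on UNIV (\<lambda>y. f (left y) (right y))" and "ptime_on X a" "ptime_on X l"
  shows "ptime_on X (\<lambda>x. tmap (f (a x)) (l x))"
proof -
  obtain b where b: "poly_bounded b" "mono b"
    and le: "\<And>x. size (f (left x) (right x)) \<le> b (size x)"
    using ptime_on_size[OF f] by auto
  obtain p where p: "\<And>n. b n \<le> poly p n" using b unfolding poly_bounded_def by blast
  show ?thesis
  proof (rule ptime_on_rec[where F = "\<lambda>c. tmap (f c)" and z = "\<lambda>_. Leaf"])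
    show "tmap (f c) (Node h t) = (\<lambda>y. Node ((\<lambda>y. f (left y) (right y)) (Node (left y) (left (right y))))
       (right (right (right y)))) (Node c (Node h (Node t (tmap (f c) t))))" for c h t
      by simp
    show "ptime_on UNIV (\<lambda>y. Node ((\<lambda>y. f (left y) (right y)) (Node (left y) (left (right y))))
       (right (right (right y))))"
      by (rule ptime_on_node, rule ptime_on_comp_UNIV[OF f]) (intro ptime_intros)+
    show "size (tmap (f c) l) \<le> (size c + size l) * (1 + poly p (1 + (size c + size l)))" for c l
    proof -
      \<comment> \<open>The bound \<open>m\<close> is fixed before the induction, so that one value
        of the polynomial bounds the image of every element.\<close>
      have "size (tmap (f c) l) \<le> size l * (1 + poly p (1 + size c + m))" if "size l \<le> m" for m
        using that
      proof (induction l)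
        case (Node h t)
        have "size (f c h) \<le> b (1 + size c + size h)" using le[of "Node c h"] by simp
        also have "\<dots> \<le> poly p (1 + size c + size h)" by (rule p)
        also have "\<dots> \<le> poly p (1 + size c + m)" by (rule poly_nat_mono) (use Node in simp)
        finally show ?case using Node by (simp add: algebra_simps)
      qed simp
      then have "size (tmap (f c) l) \<le> size l * (1 + poly p (1 + size c + size l))" by blast
      also have "\<dots> \<le> (size c + size l) * (1 + poly p (1 + size c + size l))"
        by (rule mult_le_mono1) simp
      finally show ?thesis by (simp only: add.assoc)
    qed
  qed (rule assms tmap.simps | intro ptime_intros poly_bounded_intros)+
qed

fun texists :: "(tree \<Rightarrow> bool) \<Rightarrow> tree \<Rightarrow> bool" where
  "texists P Leaf = False"
| "texists P (Node h t) = (P h \<or> texists P t)"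

lemma texists_iff: "texists P t \<longleftrightarrow> (\<exists>x \<in> set (tree_list t). P x)"
  by (induction t) auto

lemma ptime_on_texists:
  assumes P: "ptime_on UNIV (\<lambda>y. enc_bool (P (left y) (right y)))"
    and a: "ptime_on X a" and l: "ptime_on X l"
  shows "ptime_on X (\<lambda>x. enc_bool (texists (P (a x)) (l x)))"
proof (rule ptime_on_rec[where F = "\<lambda>c t. enc_bool (texists (P c) t)" and b = "\<lambda>_. 1" and z = "\<lambda>_. Leaf"])
  show "enc_bool (texists (P c) (Node h t)) =
     (\<lambda>y. if ((\<lambda>y. P (left y) (right y)) (Node (left y) (left (right y))))
       then enc_bool True else right (right (right y)))
     (Node c (Node h (Node t (enc_bool (texists (P c) t)))))" for c h t
    by simp
  show "ptime_on UNIV (\<lambda>y. if ((\<lambda>y. P (left y) (right y)) (Node (left y) (left (right y))))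
       then enc_bool True else right (right (right y)))"
    by (intro ptime_on_if_bool, rule ptime_on_comp_UNIV[OF P]) (intro ptime_intros)+
  have "size (enc_bool c) \<le> 1" for c by (cases c) auto
  then show "size (enc_bool (texists (P c) l)) \<le> 1" for c l .
  show "enc_bool (texists (P c) Leaf) = Leaf" for c by simp
qed (rule a l | intro ptime_intros poly_bounded_intros)+

section \<open>The reduction as a program\<close>

text \<open>
  The vertices are the literal occurrences. A vertex is a \<open>Node tag (Node position literal)\<close>, where
  the tag is the code of the list of all later clauses and thereby identifies the clause.
\<close>

fun verts :: "tree \<Rightarrow> tree" where
  "verts Leaf = Leaf"
| "verts (Node cl t) =
    Node (Node t (Node Leaf (left cl)))
    (Node (Node t (Node (Node Leaf Leaf) (left (right cl))))
    (Node (Node t (Node (Node (Node Leaf Leaf) Leaf) (right (right cl))))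
      (verts t)))"

definition vertex_lit :: "tree \<Rightarrow> tree" where
  "vertex_lit v = right (right v)"

text \<open>The left subtree of a literal is its polarity, the right one its variable. Equal tags
  mean the same clause, from which a clique may take only one vertex.\<close>

definition compat :: "tree \<Rightarrow> tree \<Rightarrow> bool" where
  "compat u v \<longleftrightarrow> (if left u = left v then u = v
    else \<not> (right (vertex_lit u) = right (vertex_lit v) \<and> left (vertex_lit u) \<noteq> left (vertex_lit v)))"

lemma size_left: "size (left t) \<le> size t"
  by (cases t) auto

text \<open>Each vertex repeats a whole tail of the formula as its tag, hence a quadratic
  bound.\<close>

lemma size_verts: "size (verts l) \<le> size l * (3 * size l + 20)"
proof -
  have "size (verts l) \<le> size l * (3 * m + 20)" if "size l \<le> m" for m
    using that
  proof (induction l)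
    case (Node c t)
    have c: "size (left c) + (size (left (right c)) + size (right (right c))) \<le> size c"
    proof (cases c)
      case c: (Node c1 c2)
      then show ?thesis by (cases c2) auto
    qed simp
    have "size (verts (Node c t)) \<le> 3 * size t + size c + 20 + size (verts t)"
      using c by simp
    also have "\<dots> \<le> 3 * m + 20 + size c * (3 * m + 20) + size t * (3 * m + 20)"
      using Node by (auto simp: algebra_simps)
    finally show ?case by (simp add: algebra_simps)
  qed simp
  then show ?thesis by blast
qed

lemma ptime_on_verts:
  assumes "ptime_on X f"
  shows "ptime_on X (\<lambda>x. verts (f x))"
proof (rule ptime_on_rec[where F = "\<lambda>c. verts" and z = "\<lambda>_. Leaf"])
  let ?v = "\<lambda>y p l. Node (left (right (right y))) (Node p l)"
  let ?c = "\<lambda>y. left (right y)"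
  show "verts (Node h t) = (\<lambda>y. Node (?v y Leaf (left (?c y)))
    (Node (?v y (Node Leaf Leaf) (left (right (?c y))))
    (Node (?v y (Node (Node Leaf Leaf) Leaf) (right (right (?c y))))
       (right (right (right y)))))) (Node c (Node h (Node t (verts t))))" for c h t
    by simp
  show "size (verts l) \<le> (size c + size l) * (3 * (size c + size l) + 20)" for c l :: tree
    by (rule order_trans[OF size_verts]) (auto intro: mult_le_mono)
  show "ptime_on X (\<lambda>x. Leaf)" by (intro ptime_intros)
qed (rule assms verts.simps | intro ptime_intros poly_bounded_intros)+

text \<open>The inner map has to know the row vertex, which is therefore packed into its
  parameter.\<close>

definition mat_tree :: "(tree \<Rightarrow> tree \<Rightarrow> tree) \<Rightarrow> tree \<Rightarrow> tree \<Rightarrow> tree" where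
  "mat_tree f c V = tmap (\<lambda>u. tmap (f (Node c u)) V) V"

lemma ptime_on_mat_tree:
  assumes f: "ptime_on UNIV (\<lambda>y. f (left y) (right y))" and "ptime_on X c" "ptime_on X V"
  shows "ptime_on X (\<lambda>x. mat_tree f (c x) (V x))"
proof -
  have "ptime_on X (\<lambda>x. tmap ((\<lambda>a u. tmap (f (Node (left a) u)) (right a)) (Node (c x) (V x))) (V x))"
    by (intro ptime_on_tmap[OF f] ptime_on_tmap ptime_intros assms)
  then show ?thesis by (simp add: mat_tree_def)
qed

definition dimt :: "tree \<Rightarrow> nat" where
  "dimt x = spine (verts x)"

text \<open>
  The factor 64 is chosen such that \<open>9 * 65\<^sup>2 \<le> 10 * 63\<^sup>2\<close>, which is what the error bound
  \<open>1 / (20 d)\<close> requires.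
\<close>

definition diag_entry :: "nat \<Rightarrow> nat" where
  "diag_entry d = (8 * d)\<^sup>2"

definition response_entry :: "nat \<Rightarrow> nat \<Rightarrow> nat" where
  "response_entry d k = 3 * (diag_entry d + k)"

definition rat_nat :: "nat \<Rightarrow> tree" where
  "rat_nat n = Node (Node Leaf (enc_nat n)) (enc_nat 1)"

definition rat_neg :: "nat \<Rightarrow> tree" where
  "rat_neg n = Node (Node (enc_bool True) (enc_nat n)) (enc_nat 1)"

text \<open>Row and column are compared as trees instead of indices, which is sound because the
  vertices are pairwise distinct (\<open>distinct_vertices\<close>).\<close>

definition id_entry :: "tree \<Rightarrow> tree \<Rightarrow> tree" where
  "id_entry c v = (if right c = v then rat_nat 1 else rat_nat 0)"

text \<open>The left subtree of the parameter holds the diagonal entry and the entry for non-edges,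
  computed in advance; the right subtree is the row vertex.\<close>

definition gadget_entry :: "tree \<Rightarrow> tree \<Rightarrow> tree" where
  "gadget_entry c v = (if right c = v then left (left c)
    else if compat (right c) v then rat_nat 1 else right (left c))"

definition inst :: "tree \<Rightarrow> tree" where
  "inst x = Node (enc_nat (dimt x))
    (Node (mat_tree id_entry Leaf (verts x))
    (Node (mat_tree gadget_entry (Node (rat_nat (Suc (diag_entry (dimt x)))) (rat_neg (dimt x))) (verts x))
    (Node (tmap (\<lambda>v. rat_nat 3) (verts x))
      (tmap (\<lambda>v. rat_nat (response_entry (dimt x) (spine x))) (verts x)))))"

lemma ptime_on_inst:
  assumes f: "ptime_on X f"
  shows "ptime_on X (\<lambda>x. inst (f x))"
proof (rule ptime_on_comp_UNIV[OF _ f])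
  define dbl where "dbl = (\<lambda>l. tapp l l)"
  have dbl: "ptime_on UNIV f \<Longrightarrow> ptime_on UNIV (\<lambda>x. dbl (f x))" for f
    unfolding dbl_def by (intro ptime_on_tapp)
  have sdbl: "spine (dbl l) = 2 * spine l" for l by (simp add: dbl_def spine_tapp)
  \<comment> \<open>Three doublings give 8 d in unary. The product of this with itself is D, and
    three copies of D + k form the response entry.\<close>
  define W where "W = (\<lambda>x. dbl (dbl (dbl (verts x))))"
  define D where "D = (\<lambda>x. tmul (W x) (W x))"
  define R where "R = (\<lambda>x. tapp (tapp (D x) x) (tapp (tapp (D x) x) (tapp (D x) x)))"
  have D: "spine (D x) = diag_entry (dimt x)" for x
    by (simp add: D_def W_def sdbl spine_tmul diag_entry_def dimt_def power2_eq_square)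
  have R: "spine (R x) = response_entry (dimt x) (spine x)" for x
    by (simp add: R_def spine_tapp D response_entry_def)
  have nat: "ptime_on UNIV f \<Longrightarrow> ptime_on UNIV (\<lambda>x. rat_nat (spine (f x)))" for f
    unfolding rat_nat_def by (intro ptime_intros ptime_on_enc_nat)
  have 1: "ptime_on UNIV (\<lambda>x. enc_nat (dimt x))"
    unfolding dimt_def by (intro ptime_on_enc_nat ptime_on_verts ptime_intros)
  have 2: "ptime_on UNIV (\<lambda>x. rat_neg (dimt x))"
    unfolding rat_neg_def by (intro ptime_intros 1)
  have pD: "ptime_on UNIV D" unfolding D_def W_def
    by (intro ptime_on_tmul dbl ptime_on_verts ptime_intros)
  \<comment> \<open>The extra \<open>Node\<close> adds one in unary.\<close>
  then have "ptime_on UNIV (\<lambda>x. rat_nat (spine (Node Leaf (D x))))"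
    by (intro nat ptime_intros)
  then have 3: "ptime_on UNIV (\<lambda>x. rat_nat (Suc (diag_entry (dimt x))))" by (simp add: D)
  have "ptime_on UNIV (\<lambda>x. rat_nat (spine (R x)))"
    unfolding R_def by (intro nat ptime_on_tapp pD ptime_intros)
  then have 4: "ptime_on UNIV (\<lambda>x. rat_nat (response_entry (dimt x) (spine x)))" by (simp add: R)
  have 5: "ptime_on UNIV (\<lambda>x. mat_tree id_entry Leaf (verts x))"
    by (rule ptime_on_mat_tree) (unfold id_entry_def, (intro ptime_on_verts ptime_intros)+)
  have 6: "ptime_on UNIV (\<lambda>x. mat_tree gadget_entry
      (Node (rat_nat (Suc (diag_entry (dimt x)))) (rat_neg (dimt x))) (verts x))"
    by (rule ptime_on_mat_tree)
      (unfold gadget_entry_def compat_def vertex_lit_def if_bool_eq_conj imp_conv_disj,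
        (intro ptime_on_verts ptime_intros 2 3)+)
  have 7: "ptime_on UNIV (\<lambda>x. tmap ((\<lambda>_ v. rat_nat 3) Leaf) (verts x))"
    by (rule ptime_on_tmap) (intro ptime_on_verts ptime_intros)+
  have 8: "ptime_on UNIV (\<lambda>x. tmap ((\<lambda>c v. c) (rat_nat (response_entry (dimt x) (spine x)))) (verts x))"
    by (rule ptime_on_tmap) (intro ptime_on_verts ptime_intros 4)+
  show "ptime_on UNIV inst"
    unfolding inst_def[abs_def] by (intro ptime_intros 1 5 6 7 8)
qed

text \<open>
  Comparing the numbers of binary digits of numerator and denominator separates the absolute values
  above 2 from those below 1, that is, the perturbed entries 3 from the perturbed entries 0.
\<close>

definition accept :: "tree \<Rightarrow> bool" where
  "accept q \<longleftrightarrow> tdrop (right (left q)) (right q) \<noteq> Leaf"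

text \<open>A list recursion walks along one list only. The vertex belonging to the entry
  \<open>q\<close> is found in the reversed vertex list \<open>r\<close> by dropping as many
  elements as entries follow \<open>q\<close>.\<close>

fun tselect :: "tree \<Rightarrow> tree \<Rightarrow> tree" where
  "tselect r Leaf = Leaf"
| "tselect r (Node q t) =
    (if accept q then Node (vertex_lit (left (tdrop r t))) (tselect r t) else tselect r t)"

lemma size_tselect: "size (tselect r l) \<le> size l * (size r + 1)"
proof (induction r l rule: tselect.induct)
  case (2 r q t)
  have "size (vertex_lit (left (tdrop r t))) \<le> size r"
    unfolding vertex_lit_def by (meson order_trans size_left size_right size_tdrop)
  with 2 show ?case by (cases "accept q") (auto simp: algebra_simps)
qed simp

lemma ptime_on_tselect:
  assumes "ptime_on X f" "ptime_on X g"
  shows "ptime_on X (\<lambda>x. tselect (f x) (g x))"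
proof (rule ptime_on_rec[where F = "tselect" and z = "\<lambda>_. Leaf"])
  show "tselect c (Node h t) = (\<lambda>y. if accept (left (right y))
      then Node (vertex_lit (left (tdrop (left y) (left (right (right y)))))) (right (right (right y)))
      else right (right (right y))) (Node c (Node h (Node t (tselect c t))))" for c h t
    by simp
  show "size (tselect c l) \<le> (size c + size l) * ((size c + size l) + 1)" for c l :: tree
    by (rule order_trans[OF size_tselect]) (intro mult_le_mono, simp_all)
  show "ptime_on UNIV (\<lambda>y. if accept (left (right y))
      then Node (vertex_lit (left (tdrop (left y) (left (right (right y)))))) (right (right (right y)))
      else right (right (right y)))"
    unfolding accept_def vertex_lit_def by (intro ptime_intros ptime_on_tdrop)
qed (rule assms tselect.simps | intro ptime_intros poly_bounded_intros)+

text \<open>A negative literal is tested through its positive counterpart instead of being searched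
  for, so that every list \<open>L\<close> defines a consistent assignment; variables without a
  selected positive literal are false.\<close>

definition lit_holds :: "tree \<Rightarrow> tree \<Rightarrow> bool" where
  "lit_holds L l \<longleftrightarrow> (if left l = Leaf
    then \<not> texists (\<lambda>h. Node (enc_bool True) (right l) = h) L else texists (\<lambda>h. l = h) L)"

text \<open>Negated, so that the existential search decides the universal statement about all
  clauses.\<close>

definition clause_fails :: "tree \<Rightarrow> tree \<Rightarrow> bool" where
  "clause_fails L c \<longleftrightarrow> \<not> (lit_holds L (left c) \<or> lit_holds L (left (right c)) \<or> lit_holds L (right (right c)))"

lemma ptime_on_check:
  assumes "ptime_on X f" "ptime_on X g"
  shows "ptime_on X (\<lambda>x. enc_bool (\<not> texists (clause_fails (f x)) (g x)))"
proof -
  have "lit_holds L l = ((left l = Leaf \<and> \<not> texists ((=) (Node (enc_bool True) (right l))) L) \<or>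
      (left l \<noteq> Leaf \<and> texists ((=) l) L))" for L l
    by (auto simp: lit_holds_def)
  then have lit: "ptime_on Y (\<lambda>x. enc_bool (lit_holds (f x) (g x)))"
    if "ptime_on Y f" "ptime_on Y g" for Y f g
    by (simp del: enc_bool.simps) (intro ptime_intros ptime_on_texists that)
  show ?thesis
    by (intro ptime_on_bool_not ptime_on_texists assms)
      (unfold clause_fails_def, intro lit ptime_intros)
qed

section \<open>Least squares solutions and normal equations\<close>

text \<open>A trivial kernel makes the determinant nonzero, so \<open>mat_inverse\<close> succeeds
  and \<open>the\<close> in \<open>inv_mat\<close> yields a genuine inverse.\<close>

lemma inv_mat_props:
  assumes A: "A \<in> carrier_mat n n"
    and ker: "\<And>v. v \<in> carrier_vec n \<Longrightarrow> A *\<^sub>v v = 0\<^sub>v n \<Longrightarrow> v = 0\<^sub>v n"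
  shows "inv_mat A \<in> carrier_mat n n" "A * inv_mat A = 1\<^sub>m n"
proof -
  have "det A \<noteq> 0" using det_0_iff_vec_prod_zero_field[OF A] ker by blast
  then have "A \<in> Units (ring_mat TYPE(real) n ())" by (rule det_non_zero_imp_unit[OF A])
  then obtain B where "mat_inverse A = Some B" using mat_inverse(1)[OF A, where b = "()"] by auto
  then show "inv_mat A \<in> carrier_mat n n" "A * inv_mat A = 1\<^sub>m n"
    using mat_inverse(2)[OF A] by (auto simp: inv_mat_def)
qed

lemma mult_mat_vec_index:
  assumes "A \<in> carrier_mat n n" "x \<in> carrier_vec n" "i < n"
  shows "(A *\<^sub>v x) $ i = (\<Sum>j<n. A $$ (i, j) * x $ j)"
  using assms by (auto simp: scalar_prod_def atLeast0LessThan intro!: sum.cong)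

lemma quadratic_form:
  assumes "A \<in> carrier_mat n n" "x \<in> carrier_vec n"
  shows "x \<bullet> (A *\<^sub>v x) = (\<Sum>i<n. x $ i * (\<Sum>j<n. A $$ (i, j) * x $ j))"
proof -
  have "x \<bullet> (A *\<^sub>v x) = (\<Sum>i<n. x $ i * (A *\<^sub>v x) $ i)"
    using assms by (auto simp: scalar_prod_def atLeast0LessThan intro!: sum.cong)
  then show ?thesis using mult_mat_vec_index[OF assms] by simp
qed

text \<open>Every term of the quadratic form has a zero factor, the coordinate outside
  \<open>S\<close> and the row sum inside. This is injectivity of the principal submatrix, expressed
  in full coordinates.\<close>

lemma pos_def_eq_0:
  assumes A: "A \<in> carrier_mat n n" "pos_def A" and x: "x \<in> carrier_vec n"
    and supp: "\<And>i. i < n \<Longrightarrow> i \<notin> S \<Longrightarrow> x $ i = 0"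
    and rows: "\<And>i. i \<in> S \<Longrightarrow> i < n \<Longrightarrow> (\<Sum>j<n. A $$ (i, j) * x $ j) = 0"
  shows "x = 0\<^sub>v n"
proof (rule ccontr)
  assume "x \<noteq> 0\<^sub>v n"
  then have "x \<bullet> (A *\<^sub>v x) > 0" using A x unfolding pos_def_def by auto
  moreover have "x \<bullet> (A *\<^sub>v x) = 0"
    unfolding quadratic_form[OF A(1) x]
  proof (rule sum.neutral, safe)
    fix i assume "i < n"
    then show "x $ i * (\<Sum>j<n. A $$ (i, j) * x $ j) = 0"
      using supp[of i] rows[of i] by (cases "i \<in> S") auto
  qed
  ultimately show False by simp
qed

lemma rank_bij_betw:
  fixes S :: "nat set"
  assumes "finite S"
  shows "bij_betw (\<lambda>i. card {a \<in> S. a < i}) S {..<card S}"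
proof -
  have inj: "inj_on (\<lambda>i. card {a \<in> S. a < i}) S"
    by (metis (no_types, lifting) inj_onI pick_card_in_set)
  moreover have "(\<lambda>i. card {a \<in> S. a < i}) ` S = {..<card S}"
  proof (rule card_subset_eq)
    show "(\<lambda>i. card {a \<in> S. a < i}) ` S \<subseteq> {..<card S}"
    proof (clarsimp)
      fix i assume "i \<in> S"
      then have "{a \<in> S. a < i} \<subset> S" by auto
      then show "card {a \<in> S. a < i} < card S" using assms by (rule psubset_card_mono[rotated])
    qed
    show "card ((\<lambda>i. card {a \<in> S. a < i}) ` S) = card {..<card S}"
      using card_image[OF inj] by simp
  qed simp
  ultimately show ?thesis by (simp add: bij_betw_def)
qed

text \<open>The rank of an index within \<open>S\<close> is its position in the submatrix, and the
  zero extension contributes only zero terms outside \<open>S\<close>.\<close>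

lemma submatrix_mult_index:
  assumes A: "A \<in> carrier_mat n n" and S: "S \<subseteq> {..<n}" and w: "w \<in> carrier_vec (card S)"
    and i: "i \<in> S"
  shows "(submatrix A S S *\<^sub>v w) $ card {a \<in> S. a < i} =
    (\<Sum>j<n. A $$ (i, j) * zero_extend n S w $ j)"
proof -
  let ?r = "\<lambda>i. card {a \<in> S. a < i}"
  have fin: "finite S" using finite_subset[OF S] by simp
  have set: "{i. i < n \<and> i \<in> S} = S" using S by auto
  have B: "submatrix A S S \<in> carrier_mat (card S) (card S)"
    using carrier_matD[OF A] by (intro carrier_matI) (simp_all add: dim_submatrix set)
  have "?r i < card S" using rank_bij_betw[OF fin] i by (auto simp: bij_betw_def)
  then have "(submatrix A S S *\<^sub>v w) $ ?r i = (\<Sum>l<card S. submatrix A S S $$ (?r i, l) * w $ l)"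
    by (rule mult_mat_vec_index[OF B w])
  also have "\<dots> = (\<Sum>j\<in>S. submatrix A S S $$ (?r i, ?r j) * w $ ?r j)"
    by (rule sum.reindex_bij_betw[OF rank_bij_betw[OF fin], symmetric])
  also have "\<dots> = (\<Sum>j\<in>S. A $$ (i, j) * zero_extend n S w $ j)"
  proof (rule sum.cong)
    fix j assume "j \<in> S"
    then have "submatrix A S S $$ (?r i, ?r j) = A $$ (i, j)" "zero_extend n S w $ j = w $ ?r j"
      using A S i by (auto intro!: submatrix_index_card simp: zero_extend_def)
    then show "submatrix A S S $$ (?r i, ?r j) * w $ ?r j = A $$ (i, j) * zero_extend n S w $ j"
      by simp
  qed simp
  also have "\<dots> = (\<Sum>j<n. A $$ (i, j) * zero_extend n S w $ j)"
    using S by (intro sum.mono_neutral_left) (auto simp: zero_extend_def)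
  finally show ?thesis .
qed

lemma env_sol_carrier: "env_sol A u S \<in> carrier_vec (dim_vec u)"
  by (simp add: env_sol_def zero_extend_def)

lemma env_sol_outside: "i < dim_vec u \<Longrightarrow> i \<notin> S \<Longrightarrow> env_sol A u S $ i = 0"
  by (simp add: env_sol_def zero_extend_def)

text \<open>Together with \<open>env_sol_eqI\<close> this replaces the inverse by a linear system:
  the solution is the only vector supported in \<open>S\<close> that satisfies the rows in
  \<open>S\<close>.\<close>

lemma env_sol_normal_equation:
  assumes A: "A \<in> carrier_mat n n" "pos_def A" and u: "u \<in> carrier_vec n" and S: "S \<subseteq> {..<n}"
    and i: "i \<in> S"
  shows "(\<Sum>j<n. A $$ (i, j) * env_sol A u S $ j) = u $ i"
proof -
  let ?B = "submatrix A S S" and ?r = "\<lambda>i. card {a \<in> S. a < i}" and ?m = "card S"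
  have fin: "finite S" using finite_subset[OF S] by simp
  have set: "{i. i < n \<and> i \<in> S} = S" using S by auto
  have B: "?B \<in> carrier_mat ?m ?m"
    using carrier_matD[OF A(1)] by (intro carrier_matI) (simp_all add: dim_submatrix set)
  have r: "?r j < ?m" if "j \<in> S" for j
    using rank_bij_betw[OF fin] that by (auto simp: bij_betw_def)
  have ker: "v = 0\<^sub>v ?m" if v: "v \<in> carrier_vec ?m" "?B *\<^sub>v v = 0\<^sub>v ?m" for v
  proof -
    have "zero_extend n S v = 0\<^sub>v n"
    proof (rule pos_def_eq_0[OF A, where S = S])
      fix j assume "j \<in> S"
      then show "(\<Sum>l<n. A $$ (j, l) * zero_extend n S v $ l) = 0"
        using submatrix_mult_index[OF A(1) S v(1)] v(2) r by simp
    qed (auto simp: zero_extend_def)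
    then have z: "v $ ?r j = 0" if "j \<in> S" for j
      using that S by (auto simp: zero_extend_def vec_eq_iff)
    show ?thesis
    proof (rule eq_vecI)
      fix l assume "l < dim_vec (0\<^sub>v ?m :: real vec)"
      then have "l \<in> ?r ` S" using rank_bij_betw[OF fin] by (auto simp: bij_betw_def)
      then show "v $ l = 0\<^sub>v ?m $ l" using z r by auto
    qed (use v in auto)
  qed
  have sub: "subvector u S \<in> carrier_vec ?m" using carrier_vecD[OF u] by (simp add: subvector_def set)
  note inv = inv_mat_props[OF B ker]
  have w: "inv_mat ?B *\<^sub>v subvector u S \<in> carrier_vec ?m" using inv(1) sub by simp
  have "?B *\<^sub>v (inv_mat ?B *\<^sub>v subvector u S) = ?B * inv_mat ?B *\<^sub>v subvector u S"
    using assoc_mult_mat_vec[OF B inv(1) sub] by simp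
  also have "\<dots> = subvector u S" using inv(2) sub by simp
  finally have "(\<Sum>j<n. A $$ (i, j) * env_sol A u S $ j) = subvector u S $ ?r i"
    using submatrix_mult_index[OF A(1) S w i] u by (simp add: env_sol_def)
  also have "\<dots> = u $ i"
    using r[OF i] carrier_vecD[OF u] i by (simp add: subvector_def pick_card_in_set set)
  finally show ?thesis .
qed

lemma env_sol_eqI:
  assumes A: "A \<in> carrier_mat n n" "pos_def A" and u: "u \<in> carrier_vec n" and S: "S \<subseteq> {..<n}"
    and x: "x \<in> carrier_vec n" and supp: "\<And>i. i < n \<Longrightarrow> i \<notin> S \<Longrightarrow> x $ i = 0"
    and rows: "\<And>i. i \<in> S \<Longrightarrow> (\<Sum>j<n. A $$ (i, j) * x $ j) = u $ i"
  shows "env_sol A u S = x"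
proof -
  let ?y = "env_sol A u S"
  have y: "?y \<in> carrier_vec n" using env_sol_carrier[of A u S] u by simp
  have "?y - x = 0\<^sub>v n"
  proof (rule pos_def_eq_0[OF A, where S = S])
    show "?y - x \<in> carrier_vec n" using x y by simp
    fix i assume i: "i < n"
    show "i \<notin> S \<Longrightarrow> (?y - x) $ i = 0"
      using i supp env_sol_outside[of i u S A] u x by simp
    assume "i \<in> S"
    then have "(\<Sum>j<n. A $$ (i, j) * ?y $ j) - (\<Sum>j<n. A $$ (i, j) * x $ j) = 0"
      using rows env_sol_normal_equation[OF A u S] by simp
    then show "(\<Sum>j<n. A $$ (i, j) * (?y - x) $ j) = 0"
      using x y by (simp add: sum_subtractf algebra_simps)
  qed
  then have "(?y - x) $ i = 0" if "i < n" for i using that by simp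
  then show ?thesis using x y by (intro eq_vecI) auto
qed

lemma pooled_sol_eq_env_sol:
  assumes "A \<in> carrier_mat n n" "B \<in> carrier_mat n n" "u \<in> carrier_vec n" "v \<in> carrier_vec n"
    and S: "S \<subseteq> {..<n}"
  shows "pooled_sol A B u v S = env_sol (A + B) (u + v) S"
proof -
  have set: "{i. i < n \<and> i \<in> S} = S" using S by auto
  have pick: "pick S l < n" if "l < card S" for l
    using pick_le[of l n S] that by (simp add: set)
  have "submatrix A S S + submatrix B S S = submatrix (A + B) S S"
    using assms(1,2) pick
    by (intro eq_matI) (auto simp: dim_submatrix submatrix_index set)
  moreover have "subvector u S + subvector v S = subvector (u + v) S"
    using assms(3,4) pick by (intro eq_vecI) (auto simp: subvector_def set)
  ultimately show ?thesis using assms by (simp add: pooled_sol_def env_sol_def)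
qed

lemma pos_def_add:
  assumes "A \<in> carrier_mat n n" "B \<in> carrier_mat n n" "pos_def A" "pos_def B"
  shows "pos_def (A + B)"
proof -
  have "x \<bullet> ((A + B) *\<^sub>v x) > 0" if "x \<in> carrier_vec n" "x \<noteq> 0\<^sub>v n" for x
  proof -
    have "x \<bullet> ((A + B) *\<^sub>v x) = x \<bullet> (A *\<^sub>v x) + x \<bullet> (B *\<^sub>v x)"
      unfolding add_mult_distrib_mat_vec[OF assms(1,2) that(1)]
      by (rule scalar_prod_add_distrib) (use assms that in auto)
    moreover have "x \<bullet> (A *\<^sub>v x) > 0" "x \<bullet> (B *\<^sub>v x) > 0"
      using assms that unfolding pos_def_def by auto
    ultimately show ?thesis by simp
  qed
  moreover have "transpose_mat (A + B) = A + B"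
    using assms transpose_add[OF assms(1,2)] by (simp add: pos_def_def)
  ultimately show ?thesis using assms by (auto simp: pos_def_def)
qed

lemma pos_def_inv_mat:
  assumes A: "A \<in> carrier_mat n n" "pos_def A" and u: "u \<in> carrier_vec n"
  shows "inv_mat A *\<^sub>v u \<in> carrier_vec n" "A *\<^sub>v (inv_mat A *\<^sub>v u) = u"
proof -
  have ker: "v = 0\<^sub>v n" if "v \<in> carrier_vec n" "A *\<^sub>v v = 0\<^sub>v n" for v
    using that A unfolding pos_def_def by fastforce
  note inv = inv_mat_props[OF A(1) ker]
  show "inv_mat A *\<^sub>v u \<in> carrier_vec n" using inv u by simp
  have "A *\<^sub>v (inv_mat A *\<^sub>v u) = A * inv_mat A *\<^sub>v u"
    using assoc_mult_mat_vec[OF A(1) inv(1) u] by simp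
  then show "A *\<^sub>v (inv_mat A *\<^sub>v u) = u" using inv(2) u by simp
qed

section \<open>Bounds for the response moment and the error norm\<close>

lemma response_moment_pos:
  assumes A: "A \<in> carrier_mat n n" "pos_def A" and u: "u \<in> carrier_vec n" "u \<noteq> 0\<^sub>v n"
  shows "response_moment A u > 0"
proof -
  note y = pos_def_inv_mat[OF A u(1)]
  have "A *\<^sub>v 0\<^sub>v n = 0\<^sub>v n" using A(1) by (intro eq_vecI) auto
  then have "inv_mat A *\<^sub>v u \<noteq> 0\<^sub>v n" using y(2) u by metis
  then have "(inv_mat A *\<^sub>v u) \<bullet> u > 0" using y A unfolding pos_def_def by auto
  then show ?thesis using comm_scalar_prod[OF y(1) u(1)] by (simp add: response_moment_def)
qed

text \<open>If A y = u, then m |y|^2 is at most the inner product of y and u. Twice that product is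
  at most |u|^2 / m + m |y|^2, coordinate by coordinate, and the terms m |y|^2 cancel.\<close>

lemma response_moment_le:
  assumes A: "A \<in> carrier_mat n n" "pos_def A" and u: "u \<in> carrier_vec n" and m: "0 < m"
    and low: "\<And>x. x \<in> carrier_vec n \<Longrightarrow> x \<bullet> (A *\<^sub>v x) \<ge> m * (x \<bullet> x)"
  shows "response_moment A u \<le> (u \<bullet> u) / m"
proof -
  define y where "y = inv_mat A *\<^sub>v u"
  have y: "y \<in> carrier_vec n" and Ay: "A *\<^sub>v y = u"
    using pos_def_inv_mat[OF A u] by (simp_all add: y_def)
  have "m * (y \<bullet> y) \<le> y \<bullet> u" using low[OF y] Ay by simp
  moreover have "y \<bullet> u = u \<bullet> y" by (rule comm_scalar_prod[OF y u])
  moreover have "2 * (u \<bullet> y) \<le> (u \<bullet> u) / m + m * (y \<bullet> y)"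
  proof -
    have "2 * (a * b) \<le> a * a / m + m * (b * b)" for a b :: real
    proof -
      have "0 \<le> (a - m * b)\<^sup>2 / m" using m by simp
      also have "\<dots> = a * a / m + m * (b * b) - 2 * (a * b)"
        using m by (simp add: field_simps power2_eq_square)
      finally show ?thesis by simp
    qed
    then have "(\<Sum>i<n. 2 * (u $ i * y $ i)) \<le> (\<Sum>i<n. u $ i * u $ i / m + m * (y $ i * y $ i))"
      by (intro sum_mono) blast
    then show ?thesis using u y
      by (simp add: scalar_prod_def atLeast0LessThan sum.distrib sum_distrib_left sum_divide_distrib)
  qed
  ultimately show ?thesis unfolding response_moment_def y_def by linarith
qed

lemma weighted_norm_sq:
  assumes "A \<in> carrier_mat n n" "B \<in> carrier_mat n n" "x \<in> carrier_vec n"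
    and "0 \<le> x \<bullet> (A *\<^sub>v x)" "0 \<le> x \<bullet> (B *\<^sub>v x)"
  shows "(weighted_norm ((1 / 2) \<cdot>\<^sub>m (A + B)) x)\<^sup>2 = (x \<bullet> (A *\<^sub>v x) + x \<bullet> (B *\<^sub>v x)) / 2"
proof -
  have "((1 / 2) \<cdot>\<^sub>m (A + B)) *\<^sub>v x = (1 / 2) \<cdot>\<^sub>v ((A + B) *\<^sub>v x)"
    using assms by (intro eq_vecI) auto
  also have "(A + B) *\<^sub>v x = A *\<^sub>v x + B *\<^sub>v x"
    by (rule add_mult_distrib_mat_vec[OF assms(1-3)])
  finally have "x \<bullet> (((1 / 2) \<cdot>\<^sub>m (A + B)) *\<^sub>v x) = (x \<bullet> (A *\<^sub>v x) + x \<bullet> (B *\<^sub>v x)) / 2"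
    using assms by (simp add: scalar_prod_add_distrib[of _ n])
  then show ?thesis using assms by (simp add: weighted_norm_def)
qed

section \<open>Invariant solutions and cliques\<close>

definition gadget_mat :: "nat \<Rightarrow> (nat \<Rightarrow> nat \<Rightarrow> bool) \<Rightarrow> real mat" where
  "gadget_mat d E = mat d d (\<lambda>(i, j). if i = j then real (Suc (diag_entry d))
    else if E i j then 1 else - real d)"

definition clique :: "(nat \<Rightarrow> nat \<Rightarrow> bool) \<Rightarrow> nat set \<Rightarrow> bool" where
  "clique E S \<longleftrightarrow> (\<forall>i \<in> S. \<forall>j \<in> S. i \<noteq> j \<longrightarrow> E i j)"

definition scaled_indicator :: "nat \<Rightarrow> nat set \<Rightarrow> real vec" where
  "scaled_indicator d S = vec d (\<lambda>i. if i \<in> S then 3 else 0)"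

lemma gadget_mat_carrier: "gadget_mat d E \<in> carrier_mat d d"
  by (simp add: gadget_mat_def)

text \<open>Once 64 d^2 is removed from the diagonal, all entries are at most d in absolute value.
  Bounding |x_i x_j| by half the sum of the squares, this remainder costs at most d^2 |x|^2.\<close>

lemma gadget_mat_lower_bound:
  assumes d: "1 \<le> d" and x: "x \<in> carrier_vec d"
  shows "x \<bullet> (gadget_mat d E *\<^sub>v x) \<ge> 63 * (real d)\<^sup>2 * (x \<bullet> x)"
proof -
  define N where "N i j = gadget_mat d E $$ (i, j) - (if i = j then 64 * (real d)\<^sup>2 else 0)" for i j
  have N: "\<bar>N i j\<bar> \<le> real d" if "i < d" "j < d" for i j
    using that d by (auto simp: N_def gadget_mat_def diag_entry_def power_mult_distrib)
  have xx: "x \<bullet> x = (\<Sum>i<d. (x $ i)\<^sup>2)"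
    using x by (simp add: scalar_prod_def atLeast0LessThan power2_eq_square)
  have pair: "- (real d / 2 * ((x $ i)\<^sup>2 + (x $ j)\<^sup>2)) \<le> x $ i * (N i j * x $ j)"
    if "i < d" "j < d" for i j
  proof -
    have "\<bar>x $ i * (N i j * x $ j)\<bar> = \<bar>N i j\<bar> * (\<bar>x $ i\<bar> * \<bar>x $ j\<bar>)"
      by (simp add: abs_mult)
    also have "\<dots> \<le> real d * (\<bar>x $ i\<bar> * \<bar>x $ j\<bar>)"
      using N[OF that] by (intro mult_right_mono) auto
    also have "\<bar>x $ i\<bar> * \<bar>x $ j\<bar> \<le> ((x $ i)\<^sup>2 + (x $ j)\<^sup>2) / 2"
      using sum_squares_bound[of "\<bar>x $ i\<bar>" "\<bar>x $ j\<bar>"] by simp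
    finally show ?thesis by (simp add: mult_left_mono)
  qed
  have row: "(\<Sum>j<d. gadget_mat d E $$ (i, j) * x $ j) =
      64 * (real d)\<^sup>2 * x $ i + (\<Sum>j<d. N i j * x $ j)" if "i < d" for i
  proof -
    have "(\<Sum>j<d. gadget_mat d E $$ (i, j) * x $ j) =
        (\<Sum>j<d. (if i = j then 64 * (real d)\<^sup>2 * x $ j else 0) + N i j * x $ j)"
      by (rule sum.cong) (auto simp: N_def algebra_simps)
    also have "\<dots> = 64 * (real d)\<^sup>2 * x $ i + (\<Sum>j<d. N i j * x $ j)"
      using that by (simp add: sum.distrib)
    finally show ?thesis .
  qed
  have "x \<bullet> (gadget_mat d E *\<^sub>v x) =
      (\<Sum>i<d. x $ i * (64 * (real d)\<^sup>2 * x $ i + (\<Sum>j<d. N i j * x $ j)))"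
    unfolding quadratic_form[OF gadget_mat_carrier x] by (rule sum.cong) (simp_all add: row)
  also have "\<dots> = 64 * (real d)\<^sup>2 * (x \<bullet> x) + (\<Sum>i<d. \<Sum>j<d. x $ i * (N i j * x $ j))"
    unfolding xx
    by (simp add: algebra_simps sum.distrib sum_distrib_left power2_eq_square)
  also have "\<dots> \<ge> 64 * (real d)\<^sup>2 * (x \<bullet> x) +
      (\<Sum>i<d. \<Sum>j<d. - (real d / 2 * ((x $ i)\<^sup>2 + (x $ j)\<^sup>2)))"
    by (intro add_mono order_refl sum_mono pair) auto
  also have "(\<Sum>i<d. \<Sum>j<d. - (real d / 2 * ((x $ i)\<^sup>2 + (x $ j)\<^sup>2))) = - ((real d)\<^sup>2 * (x \<bullet> x))"
  proof -
    have "(\<Sum>i<d. \<Sum>j<d. - (real d / 2 * ((x $ i)\<^sup>2 + (x $ j)\<^sup>2))) =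
        - (real d / 2) * (real d * (x \<bullet> x) + real d * (x \<bullet> x))"
      unfolding xx
      by (simp only: minus_mult_left sum_distrib_left[symmetric] sum.distrib sum_constant card_lessThan)
    then show ?thesis by (simp add: power2_eq_square)
  qed
  finally show ?thesis by (simp add: algebra_simps)
qed

lemma scalar_prod_self_pos:
  fixes x :: "real vec"
  assumes "x \<in> carrier_vec n" "x \<noteq> 0\<^sub>v n"
  shows "0 < x \<bullet> x"
proof -
  obtain i where i: "i < n" "x $ i \<noteq> 0" using assms by (auto simp: vec_eq_iff)
  then have "0 < (\<Sum>i<n. x $ i * x $ i)"
    by (intro sum_pos2[of _ i]) (auto simp: zero_less_mult_iff linorder_neq_iff)
  then show ?thesis using assms(1) by (simp add: scalar_prod_def atLeast0LessThan)
qed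

lemma pos_def_id: "pos_def (1\<^sub>m d)"
  unfolding pos_def_def using scalar_prod_self_pos[of _ d] by auto

lemma pos_def_gadget_mat:
  assumes "1 \<le> d" "\<And>i j. E i j \<longleftrightarrow> E j i"
  shows "pos_def (gadget_mat d E)"
proof -
  have "x \<bullet> (gadget_mat d E *\<^sub>v x) > 0" if "x \<in> carrier_vec d" "x \<noteq> 0\<^sub>v d" for x
  proof -
    have "0 < 63 * (real d)\<^sup>2 * (x \<bullet> x)" using scalar_prod_self_pos[OF that] assms(1) by simp
    then show ?thesis using gadget_mat_lower_bound[OF assms(1) that(1), of E] by linarith
  qed
  moreover have "transpose_mat (gadget_mat d E) = gadget_mat d E"
    using assms(2) by (intro eq_matI) (auto simp: gadget_mat_def)
  ultimately show ?thesis by (auto simp: pos_def_def gadget_mat_def)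
qed

text \<open>The diagonal entry D + 1 is split so that \<open>i\<close> counts as its own neighbour
  and D stands alone, ready to cancel against the D in \<open>response_entry\<close>.\<close>

lemma gadget_row_sum:
  assumes S: "S \<subseteq> {..<d}" and i: "i \<in> S"
  shows "(\<Sum>j<d. gadget_mat d E $$ (i, j) * scaled_indicator d S $ j) =
    3 * (real (diag_entry d) + (\<Sum>j\<in>S. if i = j \<or> E i j then 1 else - real d))"
proof -
  have fin: "finite S" using finite_subset[OF S] by simp
  have "(\<Sum>j<d. gadget_mat d E $$ (i, j) * scaled_indicator d S $ j) =
      (\<Sum>j\<in>S. gadget_mat d E $$ (i, j) * 3)"
    using S by (intro sum.mono_neutral_cong_right) (auto simp: scaled_indicator_def)
  also have "\<dots> = (\<Sum>j\<in>S. 3 * ((if j = i then real (diag_entry d) else 0) +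
      (if i = j \<or> E i j then 1 else - real d)))"
  proof (rule sum.cong)
    fix j assume "j \<in> S"
    then have "i < d" "j < d" using S i by auto
    then show "gadget_mat d E $$ (i, j) * 3 = 3 * ((if j = i then real (diag_entry d) else 0) +
      (if i = j \<or> E i j then 1 else - real d))"
      by (simp add: gadget_mat_def)
  qed simp
  also have "\<dots> = 3 * (real (diag_entry d) + (\<Sum>j\<in>S. if i = j \<or> E i j then 1 else - real d))"
    using fin i by (simp add: sum.distrib sum_distrib_left[symmetric])
  finally show ?thesis .
qed

lemma gadget_normal_equations_iff:
  assumes S: "S \<subseteq> {..<d}" "S \<noteq> {}" and k: "1 \<le> k"
  shows "(\<forall>i\<in>S. (\<Sum>j<d. gadget_mat d E $$ (i, j) * scaled_indicator d S $ j) =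
      real (response_entry d k)) \<longleftrightarrow> clique E S \<and> card S = k"
proof -
  have fin: "finite S" using finite_subset[OF S(1)] by simp
  have card: "card S \<le> d" using card_mono[OF _ S(1)] by simp
  have eq: "((\<Sum>j<d. gadget_mat d E $$ (i, j) * scaled_indicator d S $ j) =
      real (response_entry d k)) \<longleftrightarrow> (\<Sum>j\<in>S. if i = j \<or> E i j then 1 else - real d) = real k"
    if "i \<in> S" for i
    unfolding gadget_row_sum[OF S(1) that] response_entry_def by simp
  have cl: "(\<Sum>j\<in>S. if i = j \<or> E i j then 1 else - real d) = real (card S)"
    if "clique E S" "i \<in> S" for i
  proof -
    have "(\<Sum>j\<in>S. if i = j \<or> E i j then 1 else - real d) = (\<Sum>j\<in>S. 1)"
      using that by (intro sum.cong) (auto simp: clique_def)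
    then show ?thesis by simp
  qed
  have "clique E S" if *: "\<And>i. i \<in> S \<Longrightarrow> (\<Sum>j\<in>S. if i = j \<or> E i j then 1 else - real d) = real k"
  proof (rule ccontr)
    assume "\<not> clique E S"
    then obtain i j where ij: "i \<in> S" "j \<in> S" "i \<noteq> j" "\<not> E i j" unfolding clique_def by blast
    let ?f = "\<lambda>j. if i = j \<or> E i j then 1 else - real d"
    \<comment> \<open>The missing edge contributes - d and the other card S - 1 <= d - 1 elements at
      most 1 each, so the sum is at most -1.\<close>
    have "sum ?f S = ?f j + sum ?f (S - {j})" by (rule sum.remove[OF fin ij(2)])
    also have "sum ?f (S - {j}) \<le> (\<Sum>j\<in>S - {j}. 1)" by (rule sum_mono) auto
    also have "(\<Sum>j\<in>S - {j}. 1) = real (card S) - 1"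
      using fin ij card_gt_0_iff[of S] by (auto simp: card_Diff_singleton)
    finally have "real k \<le> - 1" using *[OF ij(1)] ij card by simp
    then show False by simp
  qed
  then have 1: "clique E S"
    if "\<And>i. i \<in> S \<Longrightarrow> (\<Sum>j\<in>S. if i = j \<or> E i j then 1 else - real d) = real k"
    using that by blast
  obtain i where i: "i \<in> S" using S(2) by blast
  show ?thesis
  proof
    assume "\<forall>i\<in>S. (\<Sum>j<d. gadget_mat d E $$ (i, j) * scaled_indicator d S $ j) =
      real (response_entry d k)"
    then have *: "(\<Sum>j\<in>S. if i = j \<or> E i j then 1 else - real d) = real k" if "i \<in> S" for i
      using eq[OF that] that by blast
    have "clique E S" by (rule 1[OF *])
    moreover have "card S = k" using *[OF i] cl[OF \<open>clique E S\<close> i] by linarith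
    ultimately show "clique E S \<and> card S = k" by blast
  next
    assume "clique E S \<and> card S = k"
    then show "\<forall>i\<in>S. (\<Sum>j<d. gadget_mat d E $$ (i, j) * scaled_indicator d S $ j) =
      real (response_entry d k)"
      using eq cl by blast
  qed
qed

lemma id_mult_vec_sum:
  fixes x :: "real vec"
  assumes "x \<in> carrier_vec d" "i < d"
  shows "(\<Sum>j<d. 1\<^sub>m d $$ (i, j) * x $ j) = x $ i"
  using mult_mat_vec_index[OF one_carrier_mat assms] assms by simp

definition response_vec :: "nat \<Rightarrow> nat \<Rightarrow> real vec" where
  "response_vec d k = vec d (\<lambda>i. real (response_entry d k))"

lemma env_sol_id:
  assumes "S \<subseteq> {..<d}"
  shows "env_sol (1\<^sub>m d) (vec d (\<lambda>_. 3)) S = scaled_indicator d S"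
proof (rule env_sol_eqI[OF one_carrier_mat pos_def_id _ assms])
  show x: "scaled_indicator d S \<in> carrier_vec d" by (simp add: scaled_indicator_def)
  fix i assume "i \<in> S"
  then show "(\<Sum>j<d. 1\<^sub>m d $$ (i, j) * scaled_indicator d S $ j) = vec d (\<lambda>_. 3) $ i"
    using assms id_mult_vec_sum[OF x, of i] by (auto simp: scaled_indicator_def)
qed (auto simp: scaled_indicator_def)

text \<open>The first solution is the scaled indicator for every \<open>S\<close>, so agreement
  means that this indicator satisfies the second normal equations.\<close>

lemma invariant_iff_clique:
  assumes d: "1 \<le> d" and E: "\<And>i j. E i j \<longleftrightarrow> E j i" and S: "S \<subseteq> {..<d}" and k: "1 \<le> k"
  shows "env_sol (1\<^sub>m d) (vec d (\<lambda>_. 3)) S = env_sol (gadget_mat d E) (response_vec d k) S \<and>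
      scaled_indicator d S \<noteq> 0\<^sub>v d \<longleftrightarrow> clique E S \<and> card S = k"
proof (cases "S = {}")
  \<comment> \<open>Both sides are false here: the indicator is zero and \<open>k\<close> is
    positive.\<close>
  case True
  then show ?thesis using k by (auto simp: scaled_indicator_def)
next
  case False
  then obtain i where "i \<in> S" by blast
  then have "scaled_indicator d S $ i = 3" "i < d" using S by (auto simp: scaled_indicator_def)
  then have nz: "scaled_indicator d S \<noteq> 0\<^sub>v d" by (metis index_zero_vec(1) zero_neq_numeral)
  have r: "response_vec d k \<in> carrier_vec d" by (simp add: response_vec_def)
  note pd = pos_def_gadget_mat[of d E, OF d E]
  have "env_sol (gadget_mat d E) (response_vec d k) S = scaled_indicator d S \<longleftrightarrow>
    (\<forall>i\<in>S. (\<Sum>j<d. gadget_mat d E $$ (i, j) * scaled_indicator d S $ j) = real (response_entry d k))"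
  proof
    assume eq: "env_sol (gadget_mat d E) (response_vec d k) S = scaled_indicator d S"
    show "\<forall>i\<in>S. (\<Sum>j<d. gadget_mat d E $$ (i, j) * scaled_indicator d S $ j) = real (response_entry d k)"
      using env_sol_normal_equation[OF gadget_mat_carrier pd r S] S
      unfolding eq by (auto simp: response_vec_def)
  next
    assume "\<forall>i\<in>S. (\<Sum>j<d. gadget_mat d E $$ (i, j) * scaled_indicator d S $ j) = real (response_entry d k)"
    then show "env_sol (gadget_mat d E) (response_vec d k) S = scaled_indicator d S"
      using S by (intro env_sol_eqI[OF gadget_mat_carrier pd r S])
        (auto simp: scaled_indicator_def response_vec_def)
  qed
  then show ?thesis
    unfolding env_sol_id[OF S] using nz gadget_normal_equations_iff[OF S False k] by auto
qed

text \<open>A common solution satisfies the sum of the two systems, which is the pooled one. So the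
  infimum in \<open>approximates_invariant\<close> ranges over the same sets as its premise.\<close>

lemma pooled_eq_of_env_eq:
  assumes A: "A \<in> carrier_mat n n" "pos_def A" and B: "B \<in> carrier_mat n n" "pos_def B"
    and u: "u \<in> carrier_vec n" and v: "v \<in> carrier_vec n" and S: "S \<subseteq> {..<n}"
    and eq: "env_sol A u S = env_sol B v S"
  shows "pooled_sol A B u v S = env_sol A u S"
  unfolding pooled_sol_eq_env_sol[OF A(1) B(1) u v S]
proof (rule env_sol_eqI[OF _ pos_def_add[OF A(1) B(1) A(2) B(2)] _ S])
  show "env_sol A u S \<in> carrier_vec n" using env_sol_carrier[of A u S] u by simp
  fix i
  show "i < n \<Longrightarrow> i \<notin> S \<Longrightarrow> env_sol A u S $ i = 0" using env_sol_outside[of i u S A] u by simp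
  assume i: "i \<in> S"
  have "(\<Sum>j<n. (A + B) $$ (i, j) * env_sol A u S $ j) =
      (\<Sum>j<n. A $$ (i, j) * env_sol A u S $ j) + (\<Sum>j<n. B $$ (i, j) * env_sol B v S $ j)"
    unfolding eq[symmetric] using A B i S by (auto simp: sum.distrib[symmetric] algebra_simps intro!: sum.cong)
  also have "\<dots> = (u + v) $ i"
    using env_sol_normal_equation[OF A u S i] env_sol_normal_equation[OF B v S i] i S u v by auto
  finally show "(\<Sum>j<n. (A + B) $$ (i, j) * env_sol A u S $ j) = (u + v) $ i" .
qed (use assms in auto)

text \<open>An error z with |z| >= 1 would have weighted square at least (1 + l) / 2, while the
  total response moment is at most 9 d + 10 d l <= 10 d (1 + l); the quotient would reach 1 / (20
  d).\<close>

lemma approximation_decodes: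
  assumes d: "1 \<le> d" and E: "\<And>i j. E i j \<longleftrightarrow> E j i" and k: "1 \<le> k" "k \<le> d"
    and T: "T \<subseteq> {..<d}" "clique E T" "card T = k"
    and b: "b \<in> carrier_vec d"
    and app: "approximates_invariant d (1\<^sub>m d) (gadget_mat d E) (vec d (\<lambda>_. 3)) (response_vec d k) b"
  obtains S where "S \<subseteq> {..<d}" "clique E S" "card S = k"
    "\<And>i. i < d \<Longrightarrow> \<bar>b $ i - scaled_indicator d S $ i\<bar> < 1"
proof -
  let ?I = "1\<^sub>m d :: real mat" and ?A = "gadget_mat d E" and ?u = "vec d (\<lambda>_. 3) :: real vec"
    and ?v = "response_vec d k"
  note pd = pos_def_gadget_mat[of d E, OF d E]
  have v: "?v \<in> carrier_vec d" by (simp add: response_vec_def)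
  note inv = invariant_iff_clique[of d E _ k, OF d E _ k(1)]
  define val where "val S = (weighted_norm ((1 / 2) \<cdot>\<^sub>m (?I + ?A)) (b - pooled_sol ?I ?A ?u ?v S))\<^sup>2 /
        (response_moment ?I ?u + response_moment ?A ?v)" for S
  define Inv where "Inv = {S. S \<subseteq> {..<d} \<and> env_sol ?I ?u S = env_sol ?A ?v S \<and>
    env_sol ?A ?v S = pooled_sol ?I ?A ?u ?v S \<and> pooled_sol ?I ?A ?u ?v S \<noteq> 0\<^sub>v d}"
  have pool: "pooled_sol ?I ?A ?u ?v S = scaled_indicator d S"
    if "S \<subseteq> {..<d}" "env_sol ?I ?u S = env_sol ?A ?v S" for S
    using pooled_eq_of_env_eq[OF one_carrier_mat pos_def_id gadget_mat_carrier pd _ v that]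
      env_sol_id[OF that(1)] by simp
  have TI: "env_sol ?I ?u T = env_sol ?A ?v T" "scaled_indicator d T \<noteq> 0\<^sub>v d"
    using inv[OF T(1)] T(2,3) by auto
  have "T \<in> Inv" unfolding Inv_def using T(1) TI pool[OF T(1) TI(1)] env_sol_id[OF T(1)] by simp
  moreover have "T \<in> {S. S \<subseteq> {..<d} \<and> env_sol ?I ?u S = env_sol ?A ?v S \<and> env_sol ?A ?v S \<noteq> 0\<^sub>v d}"
    using T(1) TI env_sol_id[OF T(1)] by simp
  ultimately have "Inf (val ` Inv) < 1 / (20 * real d)" "val ` Inv \<noteq> {}"
    using app unfolding approximates_invariant_def val_def Inv_def by blast+
  \<comment> \<open>The infimum only provides some clique below the bound, possibly different from
    \<open>T\<close>.\<close>
  then obtain S where S: "S \<in> Inv" "val S < 1 / (20 * real d)"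
    using cInf_lessD[of "val ` Inv"] by auto
  have S': "S \<subseteq> {..<d}" "env_sol ?I ?u S = env_sol ?A ?v S" using S(1) by (auto simp: Inv_def)
  have p: "pooled_sol ?I ?A ?u ?v S = scaled_indicator d S" by (rule pool[OF S'])
  have cl: "clique E S" "card S = k"
    using inv[OF S'(1)] S'(2) S(1) p by (auto simp: Inv_def)
  define z where "z = b - scaled_indicator d S"
  have z: "z \<in> carrier_vec d" using b by (simp add: z_def scaled_indicator_def)
  define l where "l = 63 * (real d)\<^sup>2"
  have l: "63 \<le> l" using d by (simp add: l_def)
  have zz: "0 \<le> z \<bullet> z" by (simp add: scalar_prod_def sum_nonneg)
  have zA: "l * (z \<bullet> z) \<le> z \<bullet> (?A *\<^sub>v z)"
    using gadget_mat_lower_bound[OF d z] by (simp add: l_def)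
  have wn: "(weighted_norm ((1 / 2) \<cdot>\<^sub>m (?I + ?A)) z)\<^sup>2 = (z \<bullet> z + z \<bullet> (?A *\<^sub>v z)) / 2"
  proof -
    have "0 \<le> l * (z \<bullet> z)" using zz l by simp
    then have "0 \<le> z \<bullet> (?A *\<^sub>v z)" using zA by linarith
    then show ?thesis using weighted_norm_sq[OF one_carrier_mat gadget_mat_carrier z] zz z by simp
  qed
  have m1: "response_moment ?I ?u \<le> 9 * real d"
    using response_moment_le[OF one_carrier_mat pos_def_id, of ?u d 1]
    by (simp add: scalar_prod_def)
  have vv: "?v \<bullet> ?v = 9 * real d * (real (diag_entry d) + real k)\<^sup>2"
    by (simp add: scalar_prod_def response_vec_def response_entry_def power2_eq_square algebra_simps)
  have m2: "response_moment ?A ?v \<le> 9 * real d * (real (diag_entry d) + real k)\<^sup>2 / l"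
    unfolding vv[symmetric]
    by (rule response_moment_le[OF gadget_mat_carrier pd v])
      (use d l gadget_mat_lower_bound[OF d] in \<open>auto simp: l_def\<close>)
  have dk: "(real (diag_entry d) + real k)\<^sup>2 \<le> (65 * (real d)\<^sup>2)\<^sup>2"
  proof (rule power_mono)
    have "real k \<le> real d" using k by simp
    also have "\<dots> \<le> (real d)\<^sup>2" using d by (simp add: power2_eq_square)
    finally show "real (diag_entry d) + real k \<le> 65 * (real d)\<^sup>2"
      by (simp add: diag_entry_def power_mult_distrib)
  qed simp
  \<comment> \<open>Numerically, 9 * 65^2 = 38025 and 10 * 63^2 = 39690.\<close>
  have "(65 * (real d)\<^sup>2)\<^sup>2 * 9 \<le> 10 * l * l"
    by (simp add: l_def power2_eq_square)
  then have "9 * (real (diag_entry d) + real k)\<^sup>2 \<le> 10 * l * l" using dk by linarith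
  then have "9 * (real (diag_entry d) + real k)\<^sup>2 / l \<le> 10 * l" using l by (simp add: field_simps)
  then have "real d * (9 * (real (diag_entry d) + real k)\<^sup>2 / l) \<le> real d * (10 * l)"
    by (rule mult_left_mono) simp
  with m1 m2 have m: "response_moment ?I ?u + response_moment ?A ?v \<le> 10 * real d * (1 + l)"
    by (simp add: algebra_simps)
  define M where "M = response_moment ?I ?u + response_moment ?A ?v"
  have "0 < response_entry d k" using k by (simp add: response_entry_def)
  then have "?u $ 0 \<noteq> 0\<^sub>v d $ 0" "?v $ 0 \<noteq> 0\<^sub>v d $ 0"
    using d by (simp_all add: response_vec_def)
  then have "?u \<noteq> 0\<^sub>v d" "?v \<noteq> 0\<^sub>v d" by auto
  then have "response_moment ?I ?u > 0" "response_moment ?A ?v > 0"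
    using response_moment_pos[OF one_carrier_mat pos_def_id] v
      response_moment_pos[OF gadget_mat_carrier pd] by auto
  then have M: "0 < M" by (simp add: M_def)
  have lt1: "z \<bullet> z < 1"
  proof (rule ccontr)
    assume "\<not> z \<bullet> z < 1"
    then have "1 + l \<le> (1 + l) * (z \<bullet> z)" using l by simp
    also have "\<dots> \<le> z \<bullet> z + z \<bullet> (?A *\<^sub>v z)" using zA by (simp add: algebra_simps)
    finally have w: "(1 + l) / 2 \<le> (weighted_norm ((1 / 2) \<cdot>\<^sub>m (?I + ?A)) z)\<^sup>2" unfolding wn by simp
    have "w / M < 1 / (20 * real d) \<Longrightarrow> w < M / (20 * real d)" for w
      using M d by (simp add: field_simps)
    then have "(weighted_norm ((1 / 2) \<cdot>\<^sub>m (?I + ?A)) z)\<^sup>2 < M / (20 * real d)"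
      using S(2) by (simp add: val_def p z_def M_def)
    also have "\<dots> \<le> 10 * real d * (1 + l) / (20 * real d)"
      using m d by (intro divide_right_mono) (auto simp: M_def)
    also have "\<dots> = (1 + l) / 2" using d by (simp add: field_simps)
    finally show False using w by simp
  qed
  show thesis
  proof (rule that[OF S'(1) cl])
    fix i assume i: "i < d"
    have "(z $ i)\<^sup>2 \<le> (\<Sum>i<d. (z $ i)\<^sup>2)" using i by (intro member_le_sum) auto
    also have "\<dots> = z \<bullet> z" using z by (simp add: scalar_prod_def atLeast0LessThan power2_eq_square)
    finally have "(z $ i)\<^sup>2 < 1" using lt1 by simp
    then have "\<bar>z $ i\<bar> < 1" by (simp add: abs_square_less_1)
    then show "\<bar>b $ i - scaled_indicator d S $ i\<bar> < 1"
      using i b by (simp add: z_def scaled_indicator_def)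
  qed
qed

section \<open>Correctness of the reduction\<close>

lemma quotient_of_of_int: "quotient_of (of_int a) = (a, 1)"
  using quotient_of_int[of a] by simp

lemma enc_rat_of_nat: "enc_rat (of_nat n) = rat_nat n"
  using quotient_of_of_int[of "int n"]
  by (simp add: enc_rat_def enc_int_def rat_nat_def)

text \<open>Positivity matters: \<open>rat_neg\<close> sets the sign bit, which the code of 0 does
  not have.\<close>

lemma enc_rat_neg: "0 < n \<Longrightarrow> enc_rat (- of_nat n) = rat_neg n"
  using quotient_of_of_int[of "- int n"]
  by (simp add: enc_rat_def enc_int_def rat_neg_def)

lemma less_power_length_bits: "n < 2 ^ length (bits n)"
proof (induction n rule: bits.induct)
  case (1 n)
  show ?case
  proof (cases "n = 0")
    case False
    then have "n div 2 < 2 ^ length (bits (n div 2))" using 1 by simp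
    then show ?thesis using False by (subst bits.simps) simp
  qed simp
qed

lemma power_length_bits_le: "0 < n \<Longrightarrow> 2 ^ length (bits n) \<le> 2 * n"
proof (induction n rule: bits.induct)
  case (1 n)
  show ?case
  proof (cases "n div 2 = 0")
    case True
    then have "bits (n div 2) = []" by (simp add: bits.simps)
    then show ?thesis using 1(2) by (subst bits.simps) simp
  next
    case False
    then have "2 ^ length (bits (n div 2)) \<le> 2 * (n div 2)" using 1 by simp
    then show ?thesis using 1(2) by (subst bits.simps) simp
  qed
qed

lemma spine_enc_nat: "spine (enc_nat n) = length (bits n)"
proof -
  have "spine (enc_list enc_bool bs) = length bs" for bs
    by (induction bs) auto
  then show ?thesis by (simp add: enc_nat_def)
qed

lemma tdrop_eq_Leaf_iff: "tdrop a l = Leaf \<longleftrightarrow> spine a \<le> spine l"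
proof -
  have "tdrop a l = Leaf \<longleftrightarrow> tree_list (tdrop a l) = []" by (cases "tdrop a l") auto
  then show ?thesis by (simp add: tree_list_tdrop length_tree_list)
qed

text \<open>A positive n with L digits satisfies 2^L / 2 <= n < 2^L, so digit counts compare
  numerator and denominator up to a factor of 2. Strictly between 1 and 2 either answer may
  occur.\<close>

lemma accept_enc_rat:
  shows "accept (enc_rat q) \<Longrightarrow> 1 < \<bar>q\<bar>" and "\<not> accept (enc_rat q) \<Longrightarrow> \<bar>q\<bar> < 2"
proof -
  obtain a b where ab: "quotient_of q = (a, b)" by force
  have b: "0 < b" using quotient_of_denom_pos[OF ab] .
  have q: "\<bar>q\<bar> = of_int \<bar>a\<bar> / of_int b" using quotient_of_div[OF ab] b by simp
  let ?a = "nat \<bar>a\<bar>" and ?b = "nat b"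
  have acc: "accept (enc_rat q) \<longleftrightarrow> length (bits ?b) < length (bits ?a)"
    by (simp add: accept_def enc_rat_def ab enc_int_def tdrop_eq_Leaf_iff spine_enc_nat not_le)
  { assume "accept (enc_rat q)"
    then have len: "Suc (length (bits ?b)) \<le> length (bits ?a)" using acc by simp
    then have "?a \<noteq> 0" by (auto simp: bits.simps)
    then have "2 ^ length (bits ?a) \<le> 2 * ?a" by (intro power_length_bits_le) simp
    moreover have "(2::nat) ^ Suc (length (bits ?b)) \<le> 2 ^ length (bits ?a)"
      using len by (rule power_increasing) simp
    ultimately have "?b < ?a"
      using less_power_length_bits[of ?b] unfolding power_Suc by linarith
    then have "b < \<bar>a\<bar>" by linarith
    then show "1 < \<bar>q\<bar>" unfolding q using b by (simp del: of_int_abs) }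
  { assume "\<not> accept (enc_rat q)"
    then have "(2::nat) ^ length (bits ?a) \<le> 2 ^ length (bits ?b)"
      using acc by (intro power_increasing) auto
    then have "?a < 2 * ?b"
      using less_power_length_bits[of ?a] power_length_bits_le[of ?b] b by linarith
    then have "\<bar>a\<bar> < 2 * b" using b by simp
    then have "of_int \<bar>a\<bar> < (of_int (2 * b) :: rat)" by (simp only: of_int_less_iff)
    then show "\<bar>q\<bar> < 2" unfolding q using b by (simp add: field_simps del: of_int_abs) }
qed

lemma enc_nat_inject: "enc_nat m = enc_nat n \<Longrightarrow> m = n"
proof -
  have val: "foldr (\<lambda>b v. of_bool b + 2 * v) (bits n) 0 = n" for n :: nat
  proof (induction n rule: bits.induct)
    case (1 n)
    then show ?case by (subst bits.simps) (auto simp: bits.simps)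
  qed
  have "enc_list enc_bool bs = enc_list enc_bool cs \<Longrightarrow> bs = cs" for bs cs
  proof (induction bs arbitrary: cs)
    case Nil
    then show ?case by (cases cs) auto
  next
    case (Cons b bs)
    then obtain c cs' where "cs = c # cs'" by (cases cs) auto
    with Cons show ?case by (cases b; cases c) auto
  qed
  moreover assume "enc_nat m = enc_nat n"
  ultimately have "bits m = bits n" by (simp add: enc_nat_def)
  then show "m = n" using val by metis
qed

lemma tree_list_trevapp: "tree_list (trevapp a l) = rev (tree_list l) @ tree_list a"
  by (induction a l rule: trevapp.induct) auto

lemma tree_list_enc_list: "tree_list (enc_list f xs) = map f xs"
  by (induction xs) auto

lemma spine_enc_list: "spine (enc_list f xs) = length xs"
  by (induction xs) auto

lemma left_eq_hd: "t \<noteq> Leaf \<Longrightarrow> left t = hd (tree_list t)"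
  by (cases t) auto

lemma set_tselect:
  "length bs \<le> spine r \<Longrightarrow> set (tree_list (tselect r (enc_list f bs))) =
    {vertex_lit (tree_list r ! (length bs - 1 - i)) | i. i < length bs \<and> accept (f (bs ! i))}"
proof (induction bs)
  case (Cons b bs)
  let ?g = "\<lambda>bs i. vertex_lit (tree_list r ! (length bs - 1 - i))"
  have "tdrop r (enc_list f bs) \<noteq> Leaf"
    using Cons.prems by (simp add: tdrop_eq_Leaf_iff spine_enc_list)
  then have h: "left (tdrop r (enc_list f bs)) = tree_list r ! length bs"
    using Cons.prems
    by (simp add: left_eq_hd tree_list_tdrop spine_enc_list hd_drop_conv_nth length_tree_list)
  have "{?g (b # bs) i | i. i < length (b # bs) \<and> accept (f ((b # bs) ! i))} =
      (if accept (f b) then {?g (b # bs) 0} else {}) \<union>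
      {?g bs i | i. i < length bs \<and> accept (f (bs ! i))}" (is "?l = ?r")
  proof
    show "?l \<subseteq> ?r"
    proof
      fix t assume "t \<in> ?l"
      then obtain i where i: "t = ?g (b # bs) i" "i < length (b # bs)" "accept (f ((b # bs) ! i))"
        by blast
      then show "t \<in> ?r" by (cases i) auto
    qed
    have "?g bs i \<in> ?l" if "i < length bs" "accept (f (bs ! i))" for i
      using that by (intro CollectI exI[of _ "Suc i"]) auto
    moreover have "?g (b # bs) 0 \<in> ?l" if "accept (f b)"
      using that by (intro CollectI exI[of _ 0]) auto
    ultimately show "?r \<subseteq> ?l" by auto
  qed
  then show ?case using Cons h by auto
qed simp

section \<open>The graph of a formula\<close>

lemma compat_sym: "compat u v \<longleftrightarrow> compat v u"
  by (auto simp: compat_def)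

lemma enc_formula_Cons: "enc_formula (c # \<phi>) = Node (enc_clause c) (enc_formula \<phi>)"
  by (simp add: enc_formula_def)

abbreviation vertices :: "formula3 \<Rightarrow> tree list" where
  "vertices \<phi> \<equiv> tree_list (verts (enc_formula \<phi>))"

lemma vertices_Nil: "vertices [] = []"
  by (simp add: enc_formula_def)

lemma vertices_Cons: "vertices ((l1, l2, l3) # \<phi>) =
    Node (enc_formula \<phi>) (Node Leaf (enc_literal l1)) #
    Node (enc_formula \<phi>) (Node (Node Leaf Leaf) (enc_literal l2)) #
    Node (enc_formula \<phi>) (Node (Node (Node Leaf Leaf) Leaf) (enc_literal l3)) # vertices \<phi>"
  by (simp add: enc_formula_Cons)

lemma length_vertices: "length (vertices \<phi>) = 3 * length \<phi>"
proof (induction \<phi>)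
  case (Cons c \<phi>)
  obtain l1 l2 l3 where "c = (l1, l2, l3)" by (cases c)
  with Cons show ?case by (simp add: vertices_Cons)
qed (simp add: vertices_Nil)

text \<open>Tags are codes of proper tails, so even equal clauses at different places receive
  different tags.\<close>

lemma size_tag_less: "v \<in> set (vertices \<phi>) \<Longrightarrow> size (left v) < size (enc_formula \<phi>)"
proof (induction \<phi>)
  case (Cons c \<phi>)
  obtain l1 l2 l3 where "c = (l1, l2, l3)" by (cases c)
  with Cons show ?case by (auto simp: vertices_Cons enc_formula_Cons)
qed (simp add: vertices_Nil)

lemma tag_notin: "v \<in> set (vertices \<phi>) \<Longrightarrow> left v \<noteq> enc_formula \<phi>"
  using size_tag_less by fastforce

text \<open>The tag separates clauses; the position separates equal literals within one
  clause.\<close>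

lemma distinct_vertices: "distinct (vertices \<phi>)"
proof (induction \<phi>)
  case (Cons c \<phi>)
  obtain l1 l2 l3 where "c = (l1, l2, l3)" by (cases c)
  with Cons tag_notin[of _ \<phi>] show ?case by (force simp: vertices_Cons)
qed (simp add: vertices_Nil)

lemma card_tags: "card (left ` set (vertices \<phi>)) = length \<phi>"
proof (induction \<phi>)
  case (Cons c \<phi>)
  obtain l1 l2 l3 where "c = (l1, l2, l3)" by (cases c)
  then have "left ` set (vertices (c # \<phi>)) = insert (enc_formula \<phi>) (left ` set (vertices \<phi>))"
    by (auto simp: vertices_Cons)
  moreover have "enc_formula \<phi> \<notin> left ` set (vertices \<phi>)" using tag_notin by fastforce
  ultimately show ?case using Cons by simp
qed (simp add: vertices_Nil)

text \<open>If a clause is repeated, any one of its tags serves.\<close>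

lemma clause_tag:
  assumes "(l1, l2, l3) \<in> set \<phi>"
  shows "\<exists>\<tau> \<in> left ` set (vertices \<phi>). \<forall>v \<in> set (vertices \<phi>). left v = \<tau> \<longrightarrow>
    vertex_lit v \<in> {enc_literal l1, enc_literal l2, enc_literal l3}"
  using assms
proof (induction \<phi>)
  case (Cons c \<phi>)
  obtain m1 m2 m3 where c: "c = (m1, m2, m3)" by (cases c)
  show ?case
  proof (cases "c = (l1, l2, l3)")
    case True
    then show ?thesis using tag_notin[of _ \<phi>]
      by (intro bexI[of _ "enc_formula \<phi>"]) (auto simp: vertices_Cons vertex_lit_def)
  next
    case False
    then obtain v where v: "v \<in> set (vertices \<phi>)" "\<forall>u \<in> set (vertices \<phi>). left u = left v \<longrightarrow>
      vertex_lit u \<in> {enc_literal l1, enc_literal l2, enc_literal l3}"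
      using Cons by auto
    then show ?thesis using tag_notin[OF v(1)]
      by (intro bexI[of _ "left v"]) (auto simp: c vertices_Cons)
  qed
qed simp

lemma compat_of_true_literals:
  assumes "left u \<noteq> left v" "vertex_lit u = enc_literal l" "vertex_lit v = enc_literal m"
    "lit_true \<alpha> l" "lit_true \<alpha> m"
  shows "compat u v"
  using assms by (cases l; cases m) (auto simp: compat_def dest: enc_nat_inject)

text \<open>One true literal is chosen per clause. The last conjunct strengthens the induction:
  compatibility with the new vertex comes from the truth of the literals already chosen.\<close>

lemma clique_of_assignment:
  assumes "\<forall>(l1, l2, l3) \<in> set \<phi>. lit_true \<alpha> l1 \<or> lit_true \<alpha> l2 \<or> lit_true \<alpha> l3"
  shows "\<exists>T \<subseteq> set (vertices \<phi>). card T = length \<phi> \<and> (\<forall>u \<in> T. \<forall>v \<in> T. u \<noteq> v \<longrightarrow> compat u v) \<and>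
    (\<forall>v \<in> T. \<exists>l. vertex_lit v = enc_literal l \<and> lit_true \<alpha> l)"
  using assms
proof (induction \<phi>)
  case (Cons c \<phi>)
  obtain l1 l2 l3 where c: "c = (l1, l2, l3)" by (cases c)
  obtain T where T: "T \<subseteq> set (vertices \<phi>)" "card T = length \<phi>"
      "\<forall>u \<in> T. \<forall>v \<in> T. u \<noteq> v \<longrightarrow> compat u v"
      "\<forall>v \<in> T. \<exists>l. vertex_lit v = enc_literal l \<and> lit_true \<alpha> l"
    using Cons by auto
  obtain w l where w: "w \<in> set (vertices (c # \<phi>))" "left w = enc_formula \<phi>"
      "vertex_lit w = enc_literal l" "lit_true \<alpha> l"
  proof -
    have "lit_true \<alpha> l1 \<or> lit_true \<alpha> l2 \<or> lit_true \<alpha> l3" using Cons.prems c by simp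
    then show thesis
      using that by (elim disjE) (fastforce simp: c vertices_Cons vertex_lit_def)+
  qed
  have left: "left w \<noteq> left v" if "v \<in> T" for v
    using tag_notin[of v \<phi>] T(1) that w(2) by auto
  have comp: "compat w v" if "v \<in> T" for v
    using compat_of_true_literals[OF left[OF that] w(3) _ w(4)] T(4) that by blast
  have "w \<notin> T" using left by auto
  moreover have "finite T" using T(1) finite_subset by auto
  ultimately have "card (insert w T) = length (c # \<phi>)" using T(2) by simp
  moreover have "insert w T \<subseteq> set (vertices (c # \<phi>))"
    using T(1) w(1) by (auto simp: c vertices_Cons)
  moreover have "\<forall>u \<in> insert w T. \<forall>v \<in> insert w T. u \<noteq> v \<longrightarrow> compat u v"
    using T(3) comp compat_sym by blast
  ultimately show ?case using T(4) w(3,4) by (intro exI[of _ "insert w T"]) blast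
qed (simp add: vertices_Nil)

lemma check_iff:
  "\<not> texists (clause_fails L) (enc_formula \<phi>) \<longleftrightarrow> (\<forall>(l1, l2, l3) \<in> set \<phi>.
    lit_true (\<lambda>x. enc_literal (Pos x) \<in> set (tree_list L)) l1 \<or>
    lit_true (\<lambda>x. enc_literal (Pos x) \<in> set (tree_list L)) l2 \<or>
    lit_true (\<lambda>x. enc_literal (Pos x) \<in> set (tree_list L)) l3)"
proof -
  have "lit_holds L (enc_literal l) \<longleftrightarrow> lit_true (\<lambda>x. enc_literal (Pos x) \<in> set (tree_list L)) l" for l
    by (cases l) (auto simp: lit_holds_def texists_iff)
  then show ?thesis
    by (auto simp: enc_formula_def texists_iff tree_list_enc_list clause_fails_def split: prod.splits)
qed

text \<open>Compatible vertices have distinct tags and there are as many of them as tags, so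
  \<open>T\<close> meets every clause. A chosen negative literal holds because its positive
  counterpart cannot be chosen as well.\<close>

lemma check_of_clique:
  assumes T: "T \<subseteq> set (vertices \<phi>)" "card T = length \<phi>" "\<forall>u \<in> T. \<forall>v \<in> T. u \<noteq> v \<longrightarrow> compat u v"
    and L: "set (tree_list L) = vertex_lit ` T"
  shows "\<not> texists (clause_fails L) (enc_formula \<phi>)"
  unfolding check_iff
proof (safe, goal_cases)
  case (1 l1 l2 l3)
  let ?\<alpha> = "\<lambda>x. enc_literal (Pos x) \<in> set (tree_list L)"
  obtain \<tau> where \<tau>: "\<tau> \<in> left ` set (vertices \<phi>)" "\<And>v. v \<in> set (vertices \<phi>) \<Longrightarrow> left v = \<tau> \<Longrightarrow>
    vertex_lit v \<in> {enc_literal l1, enc_literal l2, enc_literal l3}"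
    using clause_tag[OF 1(1)] by blast
  have "inj_on left T" using T(3) by (metis compat_def inj_onI)
  then have "card (left ` T) = card (left ` set (vertices \<phi>))"
    using T(2) card_tags by (simp add: card_image)
  then have tags: "left ` T = left ` set (vertices \<phi>)"
    using T(1) by (intro card_subset_eq) auto
  then obtain v where v: "v \<in> T" "left v = \<tau>" using \<tau>(1) unfolding tags[symmetric] by blast
  have "lit_true ?\<alpha> l" if l: "vertex_lit v = enc_literal l" for l
  proof (cases l)
    case (Pos x)
    then show ?thesis using L v(1) l by force
  next
    case (Neg x)
    have False if "u \<in> T" "vertex_lit u = enc_literal (Pos x)" for u
    proof -
      have "u \<noteq> v" using that l Neg by auto
      then have "compat u v" using T(3) that(1) v(1) by blast
      then show False using \<open>u \<noteq> v\<close> that l Neg by (auto simp: compat_def split: if_splits)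
    qed
    then show ?thesis using Neg L by fastforce
  qed
  moreover have "vertex_lit v \<in> {enc_literal l1, enc_literal l2, enc_literal l3}"
    using \<tau>(2) v T(1) by blast
  ultimately show ?case using 1 by blast
qed

section \<open>The instance of a formula and the decision procedure\<close>

fun sat_instance :: "formula3 \<Rightarrow> instance_data" where
  "sat_instance \<phi> = (let d = length (vertices \<phi>) in
    (d, 1\<^sub>m d,
     mat d d (\<lambda>(i, j). if i = j then of_nat (Suc (diag_entry d))
       else if compat (vertices \<phi> ! i) (vertices \<phi> ! j) then 1 else - of_nat d),
     vec d (\<lambda>_. 3), vec d (\<lambda>_. of_nat (response_entry d (length \<phi>)))))"

lemma mat_tree_eq:
  assumes "\<And>i j. i < spine V \<Longrightarrow> j < spine V \<Longrightarrow>
    f (Node c (tree_list V ! i)) (tree_list V ! j) = enc_rat (g (i, j))"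
  shows "mat_tree f c V = enc_mat (mat (spine V) (spine V) g)"
proof -
  have V: "tree_list V = map ((!) (tree_list V)) [0..<spine V]"
    using map_nth[of "tree_list V"] by (simp add: length_tree_list)
  have "mat_tree f c V = enc_list (\<lambda>x. x) (map (\<lambda>i. enc_list (\<lambda>x. x) (map (\<lambda>j.
      f (Node c (tree_list V ! i)) (tree_list V ! j)) [0..<spine V])) [0..<spine V])"
    unfolding mat_tree_def tmap_eq enc_tree_list by (subst (1 2) V) (simp add: comp_def)
  also have "\<dots> = enc_list (\<lambda>x. x) (map (\<lambda>i. enc_list (\<lambda>x. x) (map (\<lambda>j.
      enc_rat (g (i, j))) [0..<spine V])) [0..<spine V])"
    using assms by (intro arg_cong[of _ _ "enc_list _"] map_cong) auto
  also have "\<dots> = enc_mat (mat (spine V) (spine V) g)"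
    unfolding enc_mat_def mat_to_list_def
    by (subst enc_list_id, rule arg_cong[of _ _ "enc_list _"], simp add: comp_def)
      (subst enc_list_id[of enc_rat], auto simp: comp_def intro!: arg_cong[of _ _ "enc_list _"])
  finally show ?thesis .
qed

lemma tmap_const: "f = (\<lambda>_. enc_rat q) \<Longrightarrow> tmap f V = enc_vec (vec (spine V) (\<lambda>_. q))"
  unfolding tmap_eq enc_vec_def
  by (subst enc_tree_list, subst enc_list_id[of enc_rat], rule arg_cong[of _ _ "enc_list _"])
    (simp add: map_replicate_const length_tree_list)

lemma inst_eq:
  assumes "\<phi> \<noteq> []"
  shows "inst (enc_formula \<phi>) = enc_instance (sat_instance \<phi>)"
proof -
  let ?x = "enc_formula \<phi>" and ?d = "length (vertices \<phi>)"
  have d: "spine (verts ?x) = ?d" "dimt ?x = ?d" by (simp_all add: length_tree_list dimt_def)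
  have pos: "0 < ?d" using assms by (simp add: length_vertices)
  have nth: "vertices \<phi> ! i = vertices \<phi> ! j \<longleftrightarrow> i = j" if "i < ?d" "j < ?d" for i j
    using that distinct_vertices by (simp add: nth_eq_iff_index_eq)
  have k: "spine ?x = length \<phi>" by (simp add: enc_formula_def spine_enc_list)
  have r01: "enc_rat 0 = rat_nat 0" "enc_rat 1 = rat_nat 1" "enc_rat 3 = rat_nat 3"
    using enc_rat_of_nat[of 0] enc_rat_of_nat[of 1] enc_rat_of_nat[of 3] by simp_all
  have "mat_tree id_entry Leaf (verts ?x) = enc_mat (1\<^sub>m ?d)"
    unfolding one_mat_def d(1)[symmetric]
    by (rule mat_tree_eq) (auto simp: id_entry_def nth d r01)
  moreover have "mat_tree gadget_entry (Node (rat_nat (Suc (diag_entry ?d))) (rat_neg ?d)) (verts ?x) =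
      enc_mat (mat ?d ?d (\<lambda>(i, j). if i = j then of_nat (Suc (diag_entry ?d))
       else if compat (vertices \<phi> ! i) (vertices \<phi> ! j) then 1 else - of_nat ?d))"
    unfolding d(1)[symmetric]
    by (rule mat_tree_eq)
      (use enc_rat_of_nat[of "Suc (diag_entry ?d)"] enc_rat_neg[OF pos] in
        \<open>auto simp: gadget_entry_def nth d r01\<close>)
  ultimately show ?thesis
    unfolding inst_def d k sat_instance.simps Let_def enc_instance.simps
    by (simp only: tmap_const[of _ 3, unfolded r01, OF refl]
        tmap_const[of _ "of_nat n" for n, unfolded enc_rat_of_nat, OF refl] d)
qed

lemma sat_instance_real:
  fixes \<phi> :: formula3
  defines "d \<equiv> length (vertices \<phi>)"
  shows "real_mat (1\<^sub>m d) = 1\<^sub>m d"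
    "real_mat (mat d d (\<lambda>(i, j). if i = j then of_nat (Suc (diag_entry d))
       else if compat (vertices \<phi> ! i) (vertices \<phi> ! j) then 1 else - of_nat d)) =
     gadget_mat d (\<lambda>i j. compat (vertices \<phi> ! i) (vertices \<phi> ! j))"
    "real_vec (vec d (\<lambda>_. 3)) = vec d (\<lambda>_. 3)"
    "real_vec (vec d (\<lambda>_. of_nat n)) = vec d (\<lambda>_. real n)"
  unfolding gadget_mat_def
  by (intro eq_matI eq_vecI; auto simp: of_rat_add of_rat_minus)+

lemma valid_sat_instance:
  assumes "\<phi> \<noteq> []"
  shows "valid_instance (sat_instance \<phi>)"
proof -
  let ?d = "length (vertices \<phi>)"
  have d: "1 \<le> ?d" using assms by (cases \<phi>) (simp_all add: length_vertices)
  show ?thesis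
    using d pos_def_gadget_mat[OF d compat_sym] pos_def_id
    unfolding sat_instance.simps Let_def valid_instance.simps sat_instance_real by simp
qed

lemma check_output_iff_satisfiable:
  assumes "\<phi> \<noteq> []" and out: "correct_output (sat_instance \<phi>) b"
  shows "\<not> texists (clause_fails (tselect (trev (verts (enc_formula \<phi>))) (enc_vec b))) (enc_formula \<phi>)
    \<longleftrightarrow> satisfiable \<phi>"
proof
  show "satisfiable \<phi>"
    if "\<not> texists (clause_fails (tselect (trev (verts (enc_formula \<phi>))) (enc_vec b))) (enc_formula \<phi>)"
    using that unfolding check_iff satisfiable_def by blast
next
  let ?vs = "vertices \<phi>"
  let ?d = "length ?vs"
  let ?E = "\<lambda>i j. compat (?vs ! i) (?vs ! j)"
  have d: "1 \<le> ?d" and k: "1 \<le> length \<phi>" "length \<phi> \<le> ?d"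
    using assms by (cases \<phi>, simp_all add: length_vertices)+
  have b: "b \<in> carrier_vec ?d" and app: "approximates_invariant ?d (1\<^sub>m ?d) (gadget_mat ?d ?E)
      (vec ?d (\<lambda>_. 3)) (response_vec ?d (length \<phi>)) (real_vec b)"
    using out unfolding sat_instance.simps Let_def correct_output.simps sat_instance_real
      response_vec_def by auto
  assume "satisfiable \<phi>"
  then obtain \<alpha> where "\<forall>(l1, l2, l3) \<in> set \<phi>. lit_true \<alpha> l1 \<or> lit_true \<alpha> l2 \<or> lit_true \<alpha> l3"
    unfolding satisfiable_def by blast
  from clique_of_assignment[OF this] obtain T where T: "T \<subseteq> set ?vs" "card T = length \<phi>"
    "\<forall>u \<in> T. \<forall>v \<in> T. u \<noteq> v \<longrightarrow> compat u v" by blast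
  let ?I = "{i. i < ?d \<and> ?vs ! i \<in> T}"
  have inj: "inj_on ((!) ?vs) {..<?d}"
    using distinct_vertices by (auto simp: inj_on_def nth_eq_iff_index_eq)
  have "(!) ?vs ` ?I = T" using T(1) by (auto simp: in_set_conv_nth subset_eq)
  then have card: "card ?I = length \<phi>"
    using T(2) card_image[of "(!) ?vs" ?I] inj by (metis (no_types, lifting) inj_on_subset lessThan_iff mem_Collect_eq subsetI)
  have "clique ?E ?I" using T(3) inj by (auto simp: clique_def inj_on_def)
  then obtain S where S: "S \<subseteq> {..<?d}" "clique ?E S" "card S = length \<phi>"
    and close: "\<And>i. i < ?d \<Longrightarrow> \<bar>real_vec b $ i - scaled_indicator ?d S $ i\<bar> < 1"
    using approximation_decodes[of ?d ?E "length \<phi>" ?I "real_vec b"] d k card app b compat_sym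
    by auto
  \<comment> \<open>Entries within 1 of 3 exceed 2 and entries within 1 of 0 stay below 1 in
    absolute value, so the ambiguous range of \<open>accept\<close> is avoided.\<close>
  have acc: "accept (enc_rat (b $ i)) \<longleftrightarrow> i \<in> S" if i: "i < ?d" for i
  proof -
    have r: "\<bar>of_rat (b $ i)\<bar> = real_of_rat \<bar>b $ i\<bar>" by (simp add: abs_if of_rat_minus)
    have c: "\<bar>real_of_rat (b $ i) - (if i \<in> S then 3 else 0)\<bar> < 1"
      using close[OF i] i b by (simp add: scaled_indicator_def)
    show ?thesis
    proof (cases "i \<in> S")
      case True
      then have "2 < \<bar>real_of_rat (b $ i)\<bar>" using c by (simp only: if_True)
      then have "real_of_rat 2 < of_rat \<bar>b $ i\<bar>" unfolding r[symmetric] by simp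
      then have "2 < \<bar>b $ i\<bar>" by (simp only: of_rat_less)
      then show ?thesis using accept_enc_rat(2)[of "b $ i"] True by force
    next
      case False
      then have "of_rat \<bar>b $ i\<bar> < real_of_rat 1" using c unfolding r[symmetric] by simp
      then have "\<bar>b $ i\<bar> < 1" by (simp only: of_rat_less)
      then show ?thesis using accept_enc_rat(1)[of "b $ i"] False by force
    qed
  qed
  let ?L = "tselect (trev (verts (enc_formula \<phi>))) (enc_vec b)"
  have rev: "tree_list (trev (verts (enc_formula \<phi>))) = rev ?vs"
    by (simp add: trev_def tree_list_trevapp)
  have len: "length (list_of_vec b) = ?d" "spine (trev (verts (enc_formula \<phi>))) = ?d"
    using b rev length_tree_list[of "trev (verts (enc_formula \<phi>))"] by auto
  have "set (tree_list ?L) = {vertex_lit (rev ?vs ! (?d - 1 - i)) | i.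
      i < ?d \<and> accept (enc_rat (list_of_vec b ! i))}"
    unfolding enc_vec_def using set_tselect[of "list_of_vec b"] len rev by simp
  also have "\<dots> = vertex_lit ` (!) ?vs ` S"
  proof -
    have "rev ?vs ! (?d - 1 - i) = ?vs ! i" if "i < ?d" for i
      using that by (simp add: rev_nth)
    moreover have "accept (enc_rat (list_of_vec b ! i)) \<longleftrightarrow> i \<in> S" if "i < ?d" for i
      using acc[OF that] b that by (simp add: list_of_vec_index)
    ultimately show ?thesis using S(1) by (auto simp: image_iff) (metis lessThan_iff subsetD)+
  qed
  finally have L: "set (tree_list ?L) = vertex_lit ` (!) ?vs ` S" .
  show "\<not> texists (clause_fails ?L) (enc_formula \<phi>)"
  proof (rule check_of_clique[OF _ _ _ L])
    show "(!) ?vs ` S \<subseteq> set ?vs" using S(1) by auto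
    show "card ((!) ?vs ` S) = length \<phi>"
      using card_image[OF inj_on_subset[OF inj S(1)]] S(3) by simp
    show "\<forall>u \<in> (!) ?vs ` S. \<forall>v \<in> (!) ?vs ` S. u \<noteq> v \<longrightarrow> compat u v"
      using S(2) by (auto simp: clique_def)
  qed
qed

theorem corollary2p4:
  assumes "poly_time_solvable enc_instance enc_vec valid_instance correct_output"
  shows "poly_time_solvable enc_formula enc_bool (\<lambda>_. True) (\<lambda>\<phi> b. b = satisfiable \<phi>)"
proof -
  obtain f where f: "ptime_on (enc_instance ` Collect valid_instance) f"
    "\<And>x. valid_instance x \<Longrightarrow> \<exists>y. f (enc_instance x) = enc_vec y \<and> correct_output x y"
    using ptime_on_of_solvable[OF assms] by blast
  \<comment> \<open>Prepending a tautology keeps satisfiability and makes the formula nonempty, as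
    the condition d >= 1 on instances demands.\<close>
  define taut where "taut = (Pos 0, Neg 0, Neg 0)"
  let ?x = "Node (enc_clause taut)"
  let ?X = "enc_formula ` Collect (\<lambda>_. True)"
  have x: "?x (enc_formula \<phi>) = enc_formula (taut # \<phi>)" for \<phi> by (simp add: enc_formula_Cons)
  have px: "ptime_on ?X ?x" by (intro ptime_intros)
  show ?thesis
  proof (rule solvable_of_ptime_on)
    \<comment> \<open>The solver may be applied since \<open>inst\<close> yields codes of valid
      instances here.\<close>
    have "ptime_on ?X (\<lambda>t. f (inst (?x t)))"
    proof (rule ptime_on_comp[OF ptime_on_inst[OF px] f(1)])
      fix t assume "t \<in> ?X"
      then obtain \<phi> where "t = enc_formula \<phi>" by blast
      then show "inst (?x t) \<in> enc_instance ` Collect valid_instance"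
        using inst_eq[of "taut # \<phi>"] valid_sat_instance[of "taut # \<phi>"] by (simp only: x) blast
    qed
    then show "ptime_on ?X (\<lambda>t. enc_bool (\<not> texists (clause_fails
        (tselect (trev (verts (?x t))) (f (inst (?x t))))) (?x t)))"
      by (intro ptime_on_check ptime_on_tselect ptime_on_trev ptime_on_verts px)
    fix \<phi>
    obtain b where b: "f (inst (?x (enc_formula \<phi>))) = enc_vec b"
      "correct_output (sat_instance (taut # \<phi>)) b"
      using f(2)[OF valid_sat_instance[of "taut # \<phi>"]] unfolding x inst_eq[of "taut # \<phi>", simplified] by auto
    have "satisfiable (taut # \<phi>) = satisfiable \<phi>"
      by (auto simp: satisfiable_def taut_def)
    then show "\<exists>y. enc_bool (\<not> texists (clause_fails
        (tselect (trev (verts (?x (enc_formula \<phi>)))) (f (inst (?x (enc_formula \<phi>))))))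
        (?x (enc_formula \<phi>))) = enc_bool y \<and> y = satisfiable \<phi>"
      using check_output_iff_satisfiable[of "taut # \<phi>" b] b unfolding x by auto
  qed
qed

end
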